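(* Let $\boldsymbol{\gamma}=(\gamma_u)_{u\subset\mathbb{N}}$ be a collection of non-negative weights, and for finite $u\subset\mathbb{N}$ put $$C_u:=\frac{2}{3^{|u|}}+\frac{1}{4^{|u|}}+4\left(\frac{23}{24}\right)^{|u|}+\left(\frac{3}{\pi^2}+\frac{5}{6}\right)^{|u|}.$$ For every $d\in\mathbb{N}$ and every odd prime $n$, there exists a generating vector $\boldsymbol{z}\in\{1,\ldots,n-1\}^d$ whose worst-case error in the space $H_{d,\boldsymbol{\gamma}}$ satisfies $$e(n,\boldsymbol{z})\leq\left(\frac{\log n}{\sqrt{n}}\sum_{\emptyset\neq u\subseteq\{1,\ldots,d\}}\gamma_u C_u\right)^{1/2}.$$ This error bound is independent of the dimension $d$ provided that $$C:=\sum_{u\subset\mathbb{N},\,|u|<\infty}\gamma_u C_u<\infty,$$ in the sense that then, for every $d\in\mathbb{N}$ and every odd prime $n$, there exists $\boldsymbol{z}\in\{1,\ldots,n-1\}^d$ with $e(n,\boldsymbol{z})\le C^{1/2}\,n^{-1/4}(\log n)^{1/2}$. Moreover, in the case of product weights, that is, $\gamma_u=\prod_{j\in u}\gamma_j$ for a sequence $\gamma_1,\gamma_2,\ldots\in\mathbb{R}_{\ge 0}$, the condition $C<\infty$ simplifies to $$\sum_{j=1}^\infty\gamma_j<\infty.$$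
   Context: Here $\log$ is the natural logarithm. The weights $\gamma_u\ge 0$ are indexed by subsets $u\subset\mathbb{N}$. The weighted unanchored Sobolev space $H_{d,\boldsymbol{\gamma}}$ of smoothness $1$ is the reproducing kernel Hilbert space of real-valued functions on $[0,1)^d$ with reproducing kernel $$K_{d,\boldsymbol{\gamma}}(\boldsymbol{x},\boldsymbol{y})=\sum_{u\subseteq\{1,\ldots,d\}}\gamma_u\prod_{j\in u}\eta(x_j,y_j),\qquad \eta(x,y)=\tfrac12 B_2(|x-y|)+B_1(x)B_1(y),$$ where $B_1(x)=x-\tfrac12$ and $B_2(x)=x^2-x+\tfrac16$ are the Bernoulli polynomials of degrees 1 and 2 (the empty product is $1$). Its norm is denoted $\|\cdot\|_{d,\boldsymbol{\gamma}}$. For $f:[0,1)^d\to\mathbb{R}$ integrable, let $I_d(f)=\int_{[0,1)^d}f(\boldsymbol{x})\,d\boldsymbol{x}$. For $\boldsymbol{z}=(z_1,\ldots,z_d)\in\{1,\ldots,n-1\}^d$, the (unshifted) rank-1 lattice rule is $$Q_{d,n,\boldsymbol{z}}(f)=\frac1n\sum_{i=0}^{n-1}f(\boldsymbol{x}_i),\qquad \boldsymbol{x}_i=\left(\left\{\frac{iz_1}{n}\right\},\ldots,\left\{\frac{iz_d}{n}\right\}\right),$$ where $\{x\}=x-\lfloor x\rfloor$. The worst-case error is $$e(n,\boldsymbol{z}):=\sup_{f\in H_{d,\boldsymbol{\gamma}},\ \|f\|_{d,\boldsymbol{\gamma}}\le 1}\left|I_d(f)-Q_{d,n,\boldsymbol{z}}(f)\right|.$$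 *)

theory Defs
  imports "HOL-Analysis.Analysis" "HOL-Computational_Algebra.Primes"
begin

section \<open>Reproducing kernel Hilbert spaces\<close>

text \<open>
  A real-valued function on \<open>X\<close> is represented by its extension by zero to the whole type, so that
  distinct elements of a space are distinct functions on \<open>X\<close> and the vector space operations are
  the pointwise ones.
\<close>

locale hilbert_function_space =
  fixes X :: "'a set"
    and H :: "('a \<Rightarrow> real) set"
    and ip :: "('a \<Rightarrow> real) \<Rightarrow> ('a \<Rightarrow> real) \<Rightarrow> real"
  assumes zero_outside: "\<And>f x. f \<in> H \<Longrightarrow> x \<notin> X \<Longrightarrow> f x = 0"
    and zero_mem: "(\<lambda>_. 0) \<in> H"
    and add_mem: "\<And>f g. f \<in> H \<Longrightarrow> g \<in> H \<Longrightarrow> (\<lambda>x. f x + g x) \<in> H"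
    and scale_mem: "\<And>c f. f \<in> H \<Longrightarrow> (\<lambda>x. c * f x) \<in> H"
    and ip_commute: "\<And>f g. f \<in> H \<Longrightarrow> g \<in> H \<Longrightarrow> ip f g = ip g f"
    and ip_add_left:
      "\<And>f g h. f \<in> H \<Longrightarrow> g \<in> H \<Longrightarrow> h \<in> H \<Longrightarrow> ip (\<lambda>x. f x + g x) h = ip f h + ip g h"
    and ip_scale_left: "\<And>c f g. f \<in> H \<Longrightarrow> g \<in> H \<Longrightarrow> ip (\<lambda>x. c * f x) g = c * ip f g"
    and ip_nonneg: "\<And>f. f \<in> H \<Longrightarrow> 0 \<le> ip f f"
    and ip_definite: "\<And>f. f \<in> H \<Longrightarrow> ip f f = 0 \<Longrightarrow> f = (\<lambda>_. 0)"
    and complete: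
      "\<And>s. (\<And>k. s k \<in> H) \<Longrightarrow>
        (\<forall>\<epsilon>>0. \<exists>N. \<forall>k\<ge>N. \<forall>l\<ge>N. sqrt (ip (\<lambda>x. s k x - s l x) (\<lambda>x. s k x - s l x)) < \<epsilon>) \<Longrightarrow>
        \<exists>f\<in>H. (\<lambda>k. sqrt (ip (\<lambda>x. s k x - f x) (\<lambda>x. s k x - f x))) \<longlonglongrightarrow> 0"

definition kernel_section :: "'a set \<Rightarrow> ('a \<Rightarrow> 'a \<Rightarrow> real) \<Rightarrow> 'a \<Rightarrow> 'a \<Rightarrow> real" where
  "kernel_section X K y = (\<lambda>x. if x \<in> X then K x y else 0)"

locale rkhs = hilbert_function_space X H ip
  for X :: "'a set" and K :: "'a \<Rightarrow> 'a \<Rightarrow> real"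
    and H :: "('a \<Rightarrow> real) set" and ip :: "('a \<Rightarrow> real) \<Rightarrow> ('a \<Rightarrow> real) \<Rightarrow> real" +
  assumes kernel_mem: "\<And>y. y \<in> X \<Longrightarrow> kernel_section X K y \<in> H"
    and reproducing: "\<And>f y. f \<in> H \<Longrightarrow> y \<in> X \<Longrightarrow> ip f (kernel_section X K y) = f y"

section \<open>The weighted unanchored Sobolev space\<close>

text \<open>Coordinates are indexed by \<open>{1..d}\<close>; the natural numbers start at 1.\<close>

definition unit_cube :: "nat \<Rightarrow> (nat \<Rightarrow> real) set" where
  "unit_cube d = {1..d} \<rightarrow>\<^sub>E {0..<1}"

definition B1 :: "real \<Rightarrow> real" where
  "B1 x = x - 1/2"

definition B2 :: "real \<Rightarrow> real" where
  "B2 x = x^2 - x + 1/6"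

definition eta :: "real \<Rightarrow> real \<Rightarrow> real" where
  "eta x y = 1/2 * B2 \<bar>x - y\<bar> + B1 x * B1 y"

definition sobolev_kernel ::
    "nat \<Rightarrow> (nat set \<Rightarrow> real) \<Rightarrow> (nat \<Rightarrow> real) \<Rightarrow> (nat \<Rightarrow> real) \<Rightarrow> real" where
  "sobolev_kernel d \<gamma> x y = (\<Sum>u\<in>Pow {1..d}. \<gamma> u * (\<Prod>j\<in>u. eta (x j) (y j)))"

section \<open>Lattice rules and worst-case error\<close>

definition cube_integral :: "nat \<Rightarrow> ((nat \<Rightarrow> real) \<Rightarrow> real) \<Rightarrow> real" where
  "cube_integral d f = set_lebesgue_integral (\<Pi>\<^sub>M j\<in>{1..d}. lborel) (unit_cube d) f"

definition lattice_point :: "nat \<Rightarrow> nat \<Rightarrow> (nat \<Rightarrow> nat) \<Rightarrow> nat \<Rightarrow> nat \<Rightarrow> real" where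
  "lattice_point d n z i = (\<lambda>j\<in>{1..d}. frac (real i * real (z j) / real n))"

definition lattice_rule ::
    "nat \<Rightarrow> nat \<Rightarrow> (nat \<Rightarrow> nat) \<Rightarrow> ((nat \<Rightarrow> real) \<Rightarrow> real) \<Rightarrow> real" where
  "lattice_rule d n z f = 1 / real n * (\<Sum>i<n. f (lattice_point d n z i))"

text \<open>The supremum is taken in the extended reals, where it is meaningful without a boundedness proof.\<close>

definition worst_case_error ::
    "nat \<Rightarrow> ((nat \<Rightarrow> real) \<Rightarrow> real) set \<Rightarrow>
      (((nat \<Rightarrow> real) \<Rightarrow> real) \<Rightarrow> ((nat \<Rightarrow> real) \<Rightarrow> real) \<Rightarrow> real) \<Rightarrow> nat \<Rightarrow> (nat \<Rightarrow> nat) \<Rightarrow> ereal" where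
  "worst_case_error d H ip n z =
    (SUP f\<in>{f \<in> H. sqrt (ip f f) \<le> 1}. ereal \<bar>cube_integral d f - lattice_rule d n z f\<bar>)"

definition generating_vectors :: "nat \<Rightarrow> nat \<Rightarrow> (nat \<Rightarrow> nat) set" where
  "generating_vectors d n = {1..d} \<rightarrow>\<^sub>E {1..n - 1}"

section \<open>Constants and weights\<close>

definition C_const :: "nat set \<Rightarrow> real" where
  "C_const u = 2 / 3 ^ card u + 1 / 4 ^ card u + 4 * (23/24) ^ card u
    + (3 / pi^2 + 5/6) ^ card u"

definition finite_index_sets :: "nat set set" where
  "finite_index_sets = {u. finite u \<and> u \<subseteq> {1..}}"

end

theory Submission
  imports Defs
begin

text \<open>
  The existence of a good generating vector is an averaging argument. In a reproducing kernel Hilbert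
  space the squared worst-case error is at most a double sum of the kernel over the quadrature points,
  minus its mean (\<open>quadrature_error_bound\<close>). Here \<open>eta\<close> has mean zero in each variable, so what
  remains is \<open>lattice_error\<close>: the sum over nonempty \<open>u\<close> of \<open>\<gamma> u\<close> times the mean over pairs
  \<open>(i, k)\<close> of products of \<open>eta\<close>-values (\<open>worst_case_error_le\<close>). Averaged over all generating
  vectors, these products factorize into powers \<open>mean_eta n i k ^ card u\<close>, and some vector is at
  least as good as the average.

  It remains to see that \<open>mean_eta n i k\<close> is small for most pairs \<open>(i, k)\<close>. For distinct nonzero
  \<open>i\<close>, \<open>k\<close> it is, up to \<open>1/(12n)\<close>, a Dedekind sum divided by \<open>n - 1\<close>. Expanding the sawtooth in a
  finite Fourier series with cotangent coefficients turns these sums into sums of products of cotangents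
  over frequencies that solve a linear congruence. As a congruence modulo a prime has only one solution,
  the absolute values add up over \<open>k\<close> to at most \<open>(\<Sum>\<bar>cot\<bar>)\<^sup>2/(4n)\<close> (\<open>sum_abs_dedekind_le\<close>),
  which is of order \<open>n (ln n)\<^sup>2\<close>. The mean of \<open>\<bar>mean_eta\<bar>\<close> over all these pairs is thus of order
  \<open>(ln n)\<^sup>2/n\<close>, well below \<open>ln n / sqrt n\<close>, while \<open>\<bar>mean_eta\<bar> \<le> 1/3\<close> throughout provides the
  geometric decay in \<open>card u\<close> (\<open>sum_mean_eta_power_le\<close>).
\<close>

section \<open>Trigonometric sums over residues\<close>

lemma frac_of_nat_div:
  assumes "n > 0"
  shows "frac (real a / real n) = real (a mod n) / real n"
proof -
  have "real a = real n * real (a div n) + real (a mod n)"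
    by (metis mult_div_mod_eq of_nat_add of_nat_mult)
  then have "real a / real n = real (a div n) + real (a mod n) / real n"
    using assms by (simp add: field_simps)
  moreover have "\<lfloor>real a / real n\<rfloor> = int (a div n)"
    by (simp add: floor_divide_of_nat_eq)
  ultimately show ?thesis
    by (simp add: frac_def)
qed

lemma sum_cos_residues:
  fixes a :: int
  assumes "n > 0"
  shows "(\<Sum>z<n. cos (2 * pi * of_int a * real z / real n)) = (if int n dvd a then real n else 0)"
proof (cases "int n dvd a")
  case True
  then obtain b where b: "a = int n * b" by blast
  have "cos (2 * pi * of_int a * real z / real n) = 1" for z
  proof -
    have "2 * pi * of_int a * real z / real n = 2 * pi * of_int (b * int z)"
      using assms b by simp
    then show ?thesis by (simp only: cos_int_2pin)
  qed
  with True show ?thesis by simp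
next
  case False
  define \<theta> where "\<theta> = pi * of_int a / real n"
  have "sin \<theta> \<noteq> 0"
  proof
    assume "sin \<theta> = 0"
    then obtain i :: int where "\<theta> = of_int i * pi" by (auto simp: sin_zero_iff_int2)
    then have "of_int a = of_int i * real n"
      using assms by (simp add: \<theta>_def field_simps)
    then have "a = i * int n"
      by (metis of_int_eq_iff of_int_mult of_int_of_nat_eq)
    with False show False by simp
  qed
  have "2 * sin \<theta> * (\<Sum>z<m. cos (2 * \<theta> * real z)) = sin ((2 * real m - 1) * \<theta>) + sin \<theta>" for m
  proof (induction m)
    case (Suc m)
    have "2 * sin \<theta> * cos (2 * \<theta> * real m) = sin ((2 * real m + 1) * \<theta>) - sin ((2 * real m - 1) * \<theta>)"
      by (simp add: sin_add sin_diff algebra_simps)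
    with Suc show ?case by (simp add: algebra_simps)
  qed simp
  from this[of n] have "2 * sin \<theta> * (\<Sum>z<n. cos (2 * \<theta> * real z)) = sin (2 * pi * of_int a - \<theta>) + sin \<theta>"
    using assms by (simp add: \<theta>_def field_simps)
  also have "\<dots> = 0"
    by (simp only: sin_diff cos_int_2pin sin_int_2pin)
  finally have "(\<Sum>z<n. cos (2 * \<theta> * real z)) = 0"
    using \<open>sin \<theta> \<noteq> 0\<close> by simp
  with False show ?thesis
    by (simp add: \<theta>_def mult_ac)
qed

lemma sum_sin_sin_residues:
  fixes a b :: int
  assumes "n > 0"
  shows "(\<Sum>z<n. sin (2 * pi * of_int a * real z / real n) * sin (2 * pi * of_int b * real z / real n))
    = real n / 2 * (of_bool (int n dvd a - b) - of_bool (int n dvd a + b))"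
proof -
  have "sin (2 * pi * of_int a * real z / real n) * sin (2 * pi * of_int b * real z / real n)
     = (cos (2 * pi * of_int (a - b) * real z / real n)
        - cos (2 * pi * of_int (a + b) * real z / real n)) / 2" for z
    by (simp add: sin_times_sin diff_divide_distrib add_divide_distrib algebra_simps)
  then show ?thesis
    by (simp only: sum_divide_distrib[symmetric] sum_subtractf sum_cos_residues[OF assms]) auto
qed

text \<open>
  Passing from \<open>w\<close> to \<open>w + 1\<close> changes each summand by \<open>cos (2(w+1)\<theta>) + cos (2w\<theta>)\<close> with
  \<open>\<theta> = \<pi>k/n\<close>, because the sine difference has a factor \<open>sin \<theta>\<close> that cancels against the
  cotangent. Orthogonality then evaluates the increment: it is \<open>n - 2\<close> at the first step, where the
  frequency \<open>w = 0\<close> is still present, and \<open>-2\<close> afterwards.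
\<close>

lemma sum_cot_sin:
  assumes "w > 0" "w < n"
  shows "(\<Sum>k\<in>{1..<n}. cot (pi * real k / real n) * sin (2 * pi * real k * real w / real n))
     = real n - 2 * real w"
  using assms
proof (induction w)
  case (Suc w)
  have n: "n > 0" using Suc by simp
  have split: "{..<n} = insert 0 {1..<n}" using n by auto
  have C: "(\<Sum>k\<in>{1..<n}. cos (2 * pi * real k * real v / real n))
      = (if n dvd v then real n else 0) - 1" for v
    using sum_cos_residues[OF n, of "int v"] unfolding split by (simp add: mult_ac)
  have step: "cot (pi * real k / real n) * sin (2 * pi * real k * real (Suc w) / real n)
      = cot (pi * real k / real n) * sin (2 * pi * real k * real w / real n)
        + (cos (2 * pi * real k * real (Suc w) / real n) + cos (2 * pi * real k * real w / real n))"
    if k: "k \<in> {1..<n}" for k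
  proof -
    define \<theta> where "\<theta> = pi * real k / real n"
    have "sin \<theta> > 0"
      using k n by (intro sin_gt_zero) (auto simp: \<theta>_def field_simps)
    moreover have "sin (2 * real (Suc w) * \<theta>) - sin (2 * real w * \<theta>)
        = 2 * cos ((2 * real w + 1) * \<theta>) * sin \<theta>"
      and "cos (2 * real (Suc w) * \<theta>) + cos (2 * real w * \<theta>)
        = 2 * cos ((2 * real w + 1) * \<theta>) * cos \<theta>"
    proof -
      have eq: "2 * real (Suc w) * \<theta> = (2 * real w + 1) * \<theta> + \<theta>"
        "2 * real w * \<theta> = (2 * real w + 1) * \<theta> - \<theta>"
        by (simp_all add: algebra_simps)
      show "sin (2 * real (Suc w) * \<theta>) - sin (2 * real w * \<theta>)
          = 2 * cos ((2 * real w + 1) * \<theta>) * sin \<theta>"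
        unfolding eq sin_add sin_diff by simp
      show "cos (2 * real (Suc w) * \<theta>) + cos (2 * real w * \<theta>)
          = 2 * cos ((2 * real w + 1) * \<theta>) * cos \<theta>"
        unfolding eq cos_add cos_diff by simp
    qed
    moreover have "cot \<theta> = cos \<theta> / sin \<theta>" by (simp add: cot_def)
    ultimately have "cot \<theta> * sin (2 * real (Suc w) * \<theta>) = cot \<theta> * sin (2 * real w * \<theta>)
        + (cos (2 * real (Suc w) * \<theta>) + cos (2 * real w * \<theta>))"
      by (simp add: diff_eq_eq distrib_left del: of_nat_Suc)
    moreover have "2 * pi * real k * real v / real n = 2 * real v * \<theta>" for v
      by (simp add: \<theta>_def)
    ultimately show ?thesis
      unfolding \<theta>_def[symmetric] by (simp only:)
  qed
  have "(\<Sum>k\<in>{1..<n}. cot (pi * real k / real n) * sin (2 * pi * real k * real (Suc w) / real n))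
    = (\<Sum>k\<in>{1..<n}. cot (pi * real k / real n) * sin (2 * pi * real k * real w / real n))
      + ((\<Sum>k\<in>{1..<n}. cos (2 * pi * real k * real (Suc w) / real n))
      + (\<Sum>k\<in>{1..<n}. cos (2 * pi * real k * real w / real n)))"
    by (simp only: sum.distrib[symmetric]) (intro sum.cong refl step)
  also have "\<dots> = real n - 2 * real (Suc w)"
  proof (cases "w = 0")
    case True
    have "\<not> n dvd 1" using Suc True by auto
    with True show ?thesis unfolding C by simp
  next
    case False
    have "\<not> n dvd w" "\<not> n dvd Suc w" using Suc False by (auto dest: dvd_imp_le)
    with False Suc show ?thesis unfolding C by simp
  qed
  finally show ?case .
qed simp

lemma sin_2pi_mod:
  assumes "n > 0"
  shows "sin (2 * pi * real k * real (w mod n) / real n) = sin (2 * pi * real k * real w / real n)"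
proof -
  have "real w = real n * real (w div n) + real (w mod n)"
    by (metis mult_div_mod_eq of_nat_add of_nat_mult)
  then have "2 * pi * real k * real w / real n
     = 2 * pi * of_int (int (k * (w div n))) + 2 * pi * real k * real (w mod n) / real n"
    using assms by (simp add: field_simps)
  then show ?thesis by (simp only: sin_add sin_int_2pin cos_int_2pin)
qed

text \<open>
  The finite Fourier expansion of the sawtooth. It fails at multiples of \<open>n\<close>: the sine sum vanishes
  there, whereas \<open>B1 0 = -1/2\<close>. This is why residues divisible by \<open>n\<close> are kept apart below.
\<close>

lemma sawtooth_fourier:
  assumes "n > 0" "\<not> n dvd w"
  shows "B1 (frac (real w / real n)) = - (1 / (2 * real n)) *
    (\<Sum>k\<in>{1..<n}. cot (pi * real k / real n) * sin (2 * pi * real k * real w / real n))"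
proof -
  have "w mod n > 0" "w mod n < n" using assms by (auto simp: mod_greater_zero_iff_not_dvd)
  from sum_cot_sin[OF this]
  have "(\<Sum>k\<in>{1..<n}. cot (pi * real k / real n) * sin (2 * pi * real k * real w / real n))
      = real n - 2 * real (w mod n)"
    by (simp only: sin_2pi_mod[OF assms(1)])
  then show ?thesis
    using assms by (simp only: frac_of_nat_div B1_def) (simp add: field_simps)
qed

lemma mult_cos_le_sin: "0 \<le> x \<Longrightarrow> x \<le> pi \<Longrightarrow> x * cos x \<le> sin (x::real)"
proof -
  assume x: "0 \<le> x" "x \<le> pi"
  have "sin 0 - 0 * cos 0 \<le> sin x - x * cos x"
  proof (rule DERIV_nonneg_imp_nondecreasing[OF x(1)])
    fix t assume t: "0 \<le> t" "t \<le> x"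
    have "((\<lambda>x. sin x - x * cos x) has_real_derivative t * sin t) (at t)"
      by (auto intro!: derivative_eq_intros)
    moreover have "t * sin t \<ge> 0" using t x by (simp add: sin_ge_zero)
    ultimately show "\<exists>y. ((\<lambda>x. sin x - x * cos x) has_real_derivative y) (at t) \<and> 0 \<le> y" by blast
  qed
  then show ?thesis by simp
qed

lemma cot_le_inverse: "0 < x \<Longrightarrow> x < pi \<Longrightarrow> cot x \<le> 1 / (x::real)"
  using mult_cos_le_sin[of x] sin_gt_zero[of x] by (simp add: cot_def field_simps)

text \<open>
  Both poles of the cotangent contribute a term, so that one bound serves for \<open>k\<close> on either side of
  \<open>n/2\<close>.
\<close>

lemma abs_cot_le:
  assumes "k \<in> {1..<n}"
  shows "\<bar>cot (pi * real k / real n)\<bar> \<le> real n / 2 * (1 / real k + 1 / real (n - k))"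
proof -
  have half: "cot (pi * real j / real n) \<le> real n / 2 * (1 / real j)" if "j \<in> {1..<n}" for j
  proof -
    have "cot (pi * real j / real n) \<le> 1 / (pi * real j / real n)"
      using that by (intro cot_le_inverse) (auto simp: field_simps)
    also have "\<dots> \<le> real n / 2 * (1 / real j)"
      using that pi_ge_two by (auto simp: field_simps)
    finally show ?thesis .
  qed
  have nk: "n - k \<in> {1..<n}" using assms by auto
  have "pi * real (n - k) / real n = pi - pi * real k / real n"
    using assms by (simp add: of_nat_diff field_simps)
  then have "cot (pi * real (n - k) / real n) = - cot (pi * real k / real n)"
    by (simp add: cot_def sin_diff cos_diff)
  moreover have "0 \<le> real n / 2 * (1 / real k)" "0 \<le> real n / 2 * (1 / real (n - k))" by simp_all
  moreover note half[OF assms] half[OF nk]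
  moreover have "\<bar>x\<bar> \<le> a + b" if "y = - x" "0 \<le> a" "0 \<le> b" "x \<le> a" "y \<le> b" for x y a b :: real
    using that by linarith
  ultimately show ?thesis
    unfolding distrib_left by blast
qed

lemma sum_abs_cot_le:
  assumes "n > 0"
  shows "(\<Sum>k\<in>{1..<n}. \<bar>cot (pi * real k / real n)\<bar>) \<le> real n * (1 + ln (real n))"
proof -
  have refl: "(\<Sum>k\<in>{1..<n}. 1 / real (n - k)) = (\<Sum>k\<in>{1..<n}. 1 / real k)"
    by (rule sum.reindex_bij_witness[of _ "\<lambda>k. n - k" "\<lambda>k. n - k"]) auto
  have "(\<Sum>k\<in>{1..<n}. 1 / real k) \<le> (\<Sum>k\<in>{1..n}. 1 / real k)"
    by (intro sum_mono2) auto
  also have "\<dots> = harm n" by (simp add: harm_def inverse_eq_divide)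
  also have "\<dots> \<le> 1 + ln (real n)"
    using euler_mascheroni_sequence_decreasing[of 1 n] assms by (simp add: harm_def)
  finally have H: "(\<Sum>k\<in>{1..<n}. 1 / real k) \<le> 1 + ln (real n)" .
  have "(\<Sum>k\<in>{1..<n}. \<bar>cot (pi * real k / real n)\<bar>)
      \<le> (\<Sum>k\<in>{1..<n}. real n / 2 * (1 / real k + 1 / real (n - k)))"
    by (intro sum_mono abs_cot_le)
  also have "\<dots> = real n * (\<Sum>k\<in>{1..<n}. 1 / real k)"
    unfolding sum_distrib_left[symmetric] sum.distrib refl by simp
  also have "\<dots> \<le> real n * (1 + ln (real n))"
    using H by (intro mult_left_mono) auto
  finally show ?thesis .
qed

text \<open>
  A Dedekind-type sum as a cotangent sum: inserting the expansion of both sawtooth factors, the sum over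
  \<open>z\<close> leaves only the frequencies with \<open>l i \<equiv> \<plusminus>m k\<close> modulo \<open>n\<close>.
\<close>

lemma sum_B1_B1_expand:
  assumes p: "prime n" and i: "i \<in> {1..<n}" and k: "k \<in> {1..<n}"
  shows "(\<Sum>z\<in>{1..<n}. B1 (frac (real (i * z) / real n)) * B1 (frac (real (k * z) / real n)))
    = 1 / (8 * real n) * (\<Sum>l\<in>{1..<n}. \<Sum>m\<in>{1..<n}. 
        cot (pi * real l / real n) * cot (pi * real m / real n) *
         (of_bool (int n dvd int (l * i) - int (m * k)) - of_bool (int n dvd int (l * i) + int (m * k))))"
proof -
  have n: "n > 0" using i by simp
  define c where "c = (\<lambda>k. cot (pi * real k / real n))"
  have ndvd: "\<not> n dvd j * z" if "j \<in> {1..<n}" "z \<in> {1..<n}" for j z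
    using that p by (auto simp: prime_dvd_mult_iff dest: dvd_imp_le)
  define S where "S = (\<lambda>l j z. sin (2 * pi * of_int (int (l * j)) * real z / real n))"
  have B: "B1 (frac (real (j * z) / real n)) = - (1 / (2 * real n)) * (\<Sum>l\<in>{1..<n}. c l * S l j z)"
    if "j \<in> {1..<n}" "z \<in> {1..<n}" for j z
    using sawtooth_fourier[OF n ndvd[OF that]] by (simp add: c_def S_def mult_ac)
  have "(\<Sum>z\<in>{1..<n}. B1 (frac (real (i * z) / real n)) * B1 (frac (real (k * z) / real n)))
     = (\<Sum>z\<in>{1..<n}. (1 / (4 * (real n)\<^sup>2)) * ((\<Sum>l\<in>{1..<n}. c l * S l i z) * (\<Sum>m\<in>{1..<n}. c m * S m k z)))"
  proof (intro sum.cong refl)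
    have alg: "(- (1 / (2 * real n)) * x) * (- (1 / (2 * real n)) * y) = 1 / (4 * (real n)\<^sup>2) * (x * y)" for x y
      by (simp add: power2_eq_square)
    fix z assume z: "z \<in> {1..<n}"
    show "B1 (frac (real (i * z) / real n)) * B1 (frac (real (k * z) / real n))
      = (1 / (4 * (real n)\<^sup>2)) * ((\<Sum>l\<in>{1..<n}. c l * S l i z) * (\<Sum>m\<in>{1..<n}. c m * S m k z))"
      unfolding B[OF i z] B[OF k z] alg ..
  qed
  also have "\<dots> = (\<Sum>z<n. (1 / (4 * (real n)\<^sup>2)) * ((\<Sum>l\<in>{1..<n}. c l * S l i z) * (\<Sum>m\<in>{1..<n}. c m * S m k z)))"
  proof -
    have "{..<n} = insert 0 {1..<n}" using n by auto
    moreover have "S l j 0 = 0" for l j by (simp add: S_def)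
    ultimately show ?thesis by simp
  qed
  also have "\<dots> = (\<Sum>z<n. (\<Sum>l\<in>{1..<n}. \<Sum>m\<in>{1..<n}. (1 / (4 * (real n)\<^sup>2)) * (c l * c m * (S l i z * S m k z))))"
  proof -
    have alg: "C * (sum f A * sum g A) = (\<Sum>l\<in>A. \<Sum>m\<in>A. C * (f l * g m))"
      for C :: real and f g :: "nat \<Rightarrow> real" and A
      unfolding sum_product sum_distrib_left[symmetric] ..
    show ?thesis unfolding alg by (simp only: mult_ac)
  qed
  also have "\<dots> = (\<Sum>l\<in>{1..<n}. \<Sum>z<n. \<Sum>m\<in>{1..<n}. (1 / (4 * (real n)\<^sup>2)) * (c l * c m * (S l i z * S m k z)))"
    by (rule sum.swap)
  also have "\<dots> = (\<Sum>l\<in>{1..<n}. \<Sum>m\<in>{1..<n}. \<Sum>z<n. (1 / (4 * (real n)\<^sup>2)) * (c l * c m * (S l i z * S m k z)))"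
    by (intro sum.cong refl sum.swap)
  also have "\<dots> = (\<Sum>l\<in>{1..<n}. \<Sum>m\<in>{1..<n}. (1 / (4 * (real n)\<^sup>2)) * (c l * c m * (real n / 2 *
      (of_bool (int n dvd int (l * i) - int (m * k)) - of_bool (int n dvd int (l * i) + int (m * k))))))"
    unfolding sum_distrib_left[symmetric] S_def sum_sin_sin_residues[OF n] by (rule refl)
  also have "\<dots> = 1 / (8 * real n) * (\<Sum>l\<in>{1..<n}. \<Sum>m\<in>{1..<n}. c l * c m *
      (of_bool (int n dvd int (l * i) - int (m * k)) - of_bool (int n dvd int (l * i) + int (m * k))))"
    unfolding sum_distrib_left using n by (intro sum.cong refl) (simp add: power2_eq_square)
  finally show ?thesis by (simp add: c_def)
qed

lemma residue_solution_unique: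
  assumes p: "prime n" and m: "m \<in> {1..<n}"
  shows "(\<Sum>k\<in>{1..<n}. of_bool (int n dvd a + int (m * k))) \<le> (1::real)"
    and "(\<Sum>k\<in>{1..<n}. of_bool (int n dvd a - int (m * k))) \<le> (1::real)"
proof -
  have inj: "k = k'" if k: "k \<in> {1..<n}" "k' \<in> {1..<n}" and "int n dvd int (m * k) - int (m * k')" for k k'
  proof -
    have "int n dvd int m * (int k - int k')" using that by (simp add: right_diff_distrib)
    moreover have "\<not> int n dvd int m" using m by (auto simp: zdvd_not_zless)
    moreover have "prime (int n)" using p by simp
    ultimately have "int n dvd int k - int k'" using prime_dvd_mult_iff by blast
    then have "int k mod int n = int k' mod int n" by (simp add: mod_eq_dvd_iff)
    then show ?thesis using k by simp
  qed
  have one: "(\<Sum>k\<in>{1..<n}. of_bool (P k)) \<le> (1::real)"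
    if "\<And>k k'. k \<in> {1..<n} \<Longrightarrow> k' \<in> {1..<n} \<Longrightarrow> P k \<Longrightarrow> P k' \<Longrightarrow> k = k'" for P
  proof -
    have "card ({1..<n} \<inter> {k. P k}) \<le> 1"
      using that by (subst One_nat_def, subst card_le_Suc0_iff_eq) auto
    then show ?thesis by (simp add: sum.inter_filter[symmetric] of_bool_def sum.If_cases Int_def flip: of_nat_le_iff)
  qed
  show "(\<Sum>k\<in>{1..<n}. of_bool (int n dvd a + int (m * k))) \<le> (1::real)"
  proof (rule one, rule inj, assumption+)
    fix k k' assume "int n dvd a + int (m * k)" "int n dvd a + int (m * k')"
    from dvd_diff[OF this] show "int n dvd int (m * k) - int (m * k')" by (simp add: algebra_simps)
  qed
  show "(\<Sum>k\<in>{1..<n}. of_bool (int n dvd a - int (m * k))) \<le> (1::real)"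
  proof (rule one, rule inj, assumption+)
    fix k k' assume "int n dvd a - int (m * k)" "int n dvd a - int (m * k')"
    from dvd_diff[OF this(2) this(1)] show "int n dvd int (m * k) - int (m * k')" by (simp add: algebra_simps)
  qed
qed

text \<open>
  For a fixed \<open>i\<close>, every pair of frequencies \<open>(l, m)\<close> survives for at most two values of \<open>k\<close>,
  one for each sign. So the absolute Dedekind sums, added over all \<open>k\<close>, cost no more than the
  cotangents themselves; a single one of them can be of order \<open>n\<close>, but few of them are large.
\<close>

lemma sum_abs_dedekind_le:
  assumes p: "prime n" and i: "i \<in> {1..<n}"
  shows "(\<Sum>k\<in>{1..<n}. \<bar>\<Sum>z\<in>{1..<n}. B1 (frac (real (i * z) / real n)) * B1 (frac (real (k * z) / real n))\<bar>)
    \<le> 1 / (4 * real n) * (\<Sum>l\<in>{1..<n}. \<bar>cot (pi * real l / real n)\<bar>)\<^sup>2"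
proof -
  have n: "n > 0" using i by simp
  define c where "c = (\<lambda>k. cot (pi * real k / real n))"
  define E where "E = (\<lambda>l m k. of_bool (int n dvd int (l * i) - int (m * k)) + of_bool (int n dvd int (l * i) + int (m * k)) :: real)"
  have E: "(\<Sum>k\<in>{1..<n}. E l m k) \<le> 2" if "m \<in> {1..<n}" for l m
    using residue_solution_unique[OF p that, of "int (l * i)"] by (simp add: E_def sum.distrib)
  have "(\<Sum>k\<in>{1..<n}. \<bar>\<Sum>z\<in>{1..<n}. B1 (frac (real (i * z) / real n)) * B1 (frac (real (k * z) / real n))\<bar>)
    \<le> (\<Sum>k\<in>{1..<n}. 1 / (8 * real n) * (\<Sum>l\<in>{1..<n}. \<Sum>m\<in>{1..<n}. \<bar>c l\<bar> * \<bar>c m\<bar> * E l m k))"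
  proof (intro sum_mono)
    fix k assume k: "k \<in> {1..<n}"
    have "\<bar>\<Sum>l\<in>{1..<n}. \<Sum>m\<in>{1..<n}. c l * c m *
         (of_bool (int n dvd int (l * i) - int (m * k)) - of_bool (int n dvd int (l * i) + int (m * k)))\<bar>
       \<le> (\<Sum>l\<in>{1..<n}. \<Sum>m\<in>{1..<n}. \<bar>c l\<bar> * \<bar>c m\<bar> * E l m k)"
      by (intro order.trans[OF sum_abs] sum_mono) (auto simp: E_def abs_mult intro!: mult_left_mono)
    then show "\<bar>\<Sum>z\<in>{1..<n}. B1 (frac (real (i * z) / real n)) * B1 (frac (real (k * z) / real n))\<bar>
       \<le> 1 / (8 * real n) * (\<Sum>l\<in>{1..<n}. \<Sum>m\<in>{1..<n}. \<bar>c l\<bar> * \<bar>c m\<bar> * E l m k)"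
      unfolding sum_B1_B1_expand[OF p i k] abs_mult[of "1 / (8 * real n)"] c_def[symmetric]
      by (intro mult_mono) (auto simp: c_def)
  qed
  also have "\<dots> = 1 / (8 * real n) * (\<Sum>l\<in>{1..<n}. \<Sum>m\<in>{1..<n}. \<bar>c l\<bar> * \<bar>c m\<bar> * (\<Sum>k\<in>{1..<n}. E l m k))"
  proof -
    have "(\<Sum>k\<in>{1..<n}. \<Sum>l\<in>{1..<n}. \<Sum>m\<in>{1..<n}. \<bar>c l\<bar> * \<bar>c m\<bar> * E l m k)
      = (\<Sum>l\<in>{1..<n}. \<Sum>k\<in>{1..<n}. \<Sum>m\<in>{1..<n}. \<bar>c l\<bar> * \<bar>c m\<bar> * E l m k)"
      by (rule sum.swap)
    also have "\<dots> = (\<Sum>l\<in>{1..<n}. \<Sum>m\<in>{1..<n}. \<Sum>k\<in>{1..<n}. \<bar>c l\<bar> * \<bar>c m\<bar> * E l m k)"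
      by (intro sum.cong refl sum.swap)
    finally show ?thesis by (simp only: sum_distrib_left[symmetric])
  qed
  also have "\<dots> \<le> 1 / (8 * real n) * (\<Sum>l\<in>{1..<n}. \<Sum>m\<in>{1..<n}. \<bar>c l\<bar> * \<bar>c m\<bar> * 2)"
    by (intro mult_left_mono sum_mono E) auto
  also have "\<dots> = 1 / (4 * real n) * (\<Sum>l\<in>{1..<n}. \<bar>c l\<bar>)\<^sup>2"
    unfolding power2_eq_square sum_product sum_distrib_right[symmetric] by simp
  finally show ?thesis by (simp add: c_def)
qed

section \<open>Averages of the kernel over one component of the generating vector\<close>

lemma eta_altdef: "eta x y = 1/3 - max x y + (x\<^sup>2 + y\<^sup>2) / 2"
  by (cases "x \<le> y") (simp_all add: eta_def B1_def B2_def max_def power2_eq_square field_simps)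

lemma abs_eta_le:
  assumes "x \<in> {0..<1}" "y \<in> {0..<1}"
  shows "\<bar>eta x y\<bar> \<le> 1/3"
proof -
  have *: "\<bar>1/3 - b + (a\<^sup>2 + b\<^sup>2) / 2\<bar> \<le> 1/3" if "0 \<le> a" "a \<le> b" "b < 1" for a b :: real
  proof -
    have sq: "a\<^sup>2 \<le> b\<^sup>2" "b\<^sup>2 \<le> b" "0 \<le> a\<^sup>2"
      using that by (auto simp: power2_eq_square mult_mono mult_left_le)
    have "0 \<le> (1 - b)\<^sup>2" by simp
    then have "2 * b \<le> 1 + b\<^sup>2" by (simp add: power2_diff)
    moreover have "\<bar>1/3 - b + (A + B) / 2\<bar> \<le> 1/3" if "2 * b \<le> 1 + B" "0 \<le> A" "A \<le> B" "B \<le> b" for A B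
      using that by (simp add: abs_le_iff field_simps)
    ultimately show ?thesis using sq by blast
  qed
  show ?thesis
    using *[of x y] *[of y x] assms by (cases "x \<le> y") (auto simp: eta_altdef max_def add.commute)
qed

definition mean_eta :: "nat \<Rightarrow> nat \<Rightarrow> nat \<Rightarrow> real" where
  "mean_eta n i k = 1 / real (n - 1) *
     (\<Sum>z\<in>{1..<n}. eta (frac (real i * real z / real n)) (frac (real k * real z / real n)))"

lemma abs_mean_eta_le: "\<bar>mean_eta n i k\<bar> \<le> 1/3"
proof (cases "n > 1")
  case True
  have "\<bar>\<Sum>z\<in>{1..<n}. eta (frac (real i * real z / real n)) (frac (real k * real z / real n))\<bar>
      \<le> (\<Sum>z\<in>{1..<n}. 1/3)"
    by (intro order.trans[OF sum_abs] sum_mono abs_eta_le) (auto simp: frac_lt_1)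
  also have "\<dots> = real (n - 1) / 3" by simp
  finally show ?thesis using True by (simp add: mean_eta_def abs_mult field_simps)
qed (auto simp: mean_eta_def)

text \<open>
  Multiplication by a unit permutes the nonzero residues.
\<close>

lemma sum_mult_residues:
  fixes f :: "int \<Rightarrow> real"
  assumes p: "prime n" and c: "\<not> int n dvd c"
  shows "(\<Sum>z\<in>{1..<n}. f (c * int z mod int n)) = (\<Sum>a\<in>{1..<n}. f (int a))"
proof -
  define h where "h = (\<lambda>z. nat (c * int z mod int n))"
  have n: "n > 0" using p by (simp add: prime_gt_0_nat)
  have pi: "prime (int n)" using p by simp
  have h: "int (h z) = c * int z mod int n" for z using n by (simp add: h_def)
  have sub: "h z \<in> {1..<n}" if z: "z \<in> {1..<n}" for z
  proof -
    have "\<not> int n dvd int z" using z by (auto simp: zdvd_not_zless)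
    then have "\<not> int n dvd c * int z" using c pi by (simp add: prime_dvd_mult_iff)
    then have "int (h z) \<noteq> 0" unfolding h by (simp add: dvd_eq_mod_eq_0)
    moreover have "int (h z) < int n" unfolding h using n by simp
    ultimately show ?thesis by auto
  qed
  have inj: "inj_on h {1..<n}"
  proof (rule inj_onI)
    fix x y assume xy: "x \<in> {1..<n}" "y \<in> {1..<n}" "h x = h y"
    then have "c * int x mod int n = c * int y mod int n" using h by metis
    then have "int n dvd c * (int x - int y)" by (simp add: mod_eq_dvd_iff right_diff_distrib)
    then have "int n dvd int x - int y" using c pi by (simp add: prime_dvd_mult_iff)
    then have "int x mod int n = int y mod int n" by (simp add: mod_eq_dvd_iff)
    then show "x = y" using xy by simp
  qed
  have "h ` {1..<n} = {1..<n}"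
    using sub inj by (intro endo_inj_surj) auto
  with inj have "bij_betw h {1..<n} {1..<n}" by (simp add: bij_betw_def)
  from sum.reindex_bij_betw[OF this, of "\<lambda>a. f (int a)"] show ?thesis by (simp only: h)
qed

lemma sum_B2_residues: "n > 0 \<Longrightarrow> (\<Sum>a\<in>{1..<n}. B2 (real a / real n)) = - (real n - 1) / (6 * real n)"
proof -
  assume n: "n > 0"
  have "(\<Sum>a\<in>{1..<Suc m}. B2 (real a * x))
     = real m * (real m + 1) * (2 * real m + 1) / 6 * x\<^sup>2 - real m * (real m + 1) / 2 * x + real m / 6"
    for m and x :: real
    by (induction m) (simp_all add: B2_def field_simps power2_eq_square)
  from this[where m = "n - 1" and x = "1 / real n"]
  have "(\<Sum>a\<in>{1..<n}. B2 (real a / real n))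
     = (real n - 1) * real n * (2 * real n - 1) / 6 * (1 / real n)\<^sup>2 - (real n - 1) * real n / 2 * (1 / real n) + (real n - 1) / 6"
    using n by (simp add: of_nat_diff algebra_simps)
  also have "\<dots> = - (real n - 1) / (6 * real n)"
    using n by (simp add: field_simps power2_eq_square)
  finally show ?thesis .
qed

text \<open>
  Since \<open>B2\<close> is symmetric about \<open>1/2\<close>, its value at \<open>\<bar>x - y\<bar>\<close> depends only on \<open>x - y\<close>
  modulo 1. The sum is therefore a complete sum over the nonzero residues \<open>(i - k) z\<close>.
\<close>

lemma sum_B2_diff:
  assumes p: "prime n" and ik: "i < n" "k < n" "i \<noteq> k"
  shows "(\<Sum>z\<in>{1..<n}. B2 \<bar>frac (real (i * z) / real n) - frac (real (k * z) / real n)\<bar>)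
    = - (real n - 1) / (6 * real n)"
proof -
  have n: "n > 0" using ik by simp
  have nd: "\<not> int n dvd int i - int k"
  proof
    assume "int n dvd int i - int k"
    then have "int i mod int n = int k mod int n" by (simp add: mod_eq_dvd_iff)
    then show False using ik by simp
  qed
  have "B2 \<bar>frac (real (i * z) / real n) - frac (real (k * z) / real n)\<bar>
     = B2 (of_int ((int i - int k) * int z mod int n) / real n)" for z
  proof -
    define a b where "a = i * z mod n" and "b = k * z mod n"
    have ab: "a < n" "b < n" using n by (auto simp: a_def b_def)
    have r: "(int i - int k) * int z mod int n = (int a - int b) mod int n"
      by (simp add: a_def b_def zmod_int left_diff_distrib mod_diff_eq)
    show ?thesis
    proof (cases "b \<le> a")
      case True
      then have "(int a - int b) mod int n = int a - int b" using ab by (intro mod_pos_pos_trivial) auto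
      then show ?thesis
        unfolding frac_of_nat_div[OF n] a_def[symmetric] b_def[symmetric] r
        using True by (simp add: diff_divide_distrib[symmetric])
    next
      case False
      have "(int a - int b) mod int n = (int a - int b + int n) mod int n" by simp
      also have "\<dots> = int a - int b + int n" using False ab by (intro mod_pos_pos_trivial) auto
      finally have m: "(int a - int b) mod int n = int a - int b + int n" .
      have refl: "B2 (1 - t) = B2 t" for t by (simp add: B2_def power2_eq_square algebra_simps)
      have "\<bar>real a / real n - real b / real n\<bar> = 1 - of_int (int a - int b + int n) / real n"
        using False n by (simp add: field_simps)
      then show ?thesis
        unfolding frac_of_nat_div[OF n] a_def[symmetric] b_def[symmetric] r m by (simp only: refl)
    qed
  qed
  then show ?thesis
    using sum_mult_residues[OF p nd, of "\<lambda>r. B2 (of_int r / real n)"] sum_B2_residues[OF n] by simp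
qed

text \<open>
  The \<open>B2\<close> part of \<open>eta\<close> averages to \<open>-1/(12n)\<close>, so only the Dedekind sum is left to be controlled.
\<close>

lemma abs_mean_eta_offdiag_le:
  assumes p: "prime n" and i: "i \<in> {1..<n}" and k: "k \<in> {1..<n}" and ik: "i \<noteq> k"
  shows "\<bar>mean_eta n i k\<bar> \<le> 1 / (12 * real n) + 1 / real (n - 1) *
    \<bar>\<Sum>z\<in>{1..<n}. B1 (frac (real (i * z) / real n)) * B1 (frac (real (k * z) / real n))\<bar>"
proof -
  define D where "D = (\<Sum>z\<in>{1..<n}. B1 (frac (real (i * z) / real n)) * B1 (frac (real (k * z) / real n)))"
  have n: "n > 1" using p by (rule prime_gt_1_nat)
  have "mean_eta n i k = 1 / real (n - 1) * (1/2 * (- (real n - 1) / (6 * real n)) + D)"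
    unfolding mean_eta_def eta_def sum.distrib sum_distrib_left[symmetric] D_def
    using sum_B2_diff[OF p _ _ ik] i k by simp
  also have "\<dots> = - (1 / (12 * real n)) + 1 / real (n - 1) * D"
    using n by (simp add: of_nat_diff field_simps)
  finally have "\<bar>mean_eta n i k\<bar> \<le> \<bar>- (1 / (12 * real n))\<bar> + \<bar>1 / real (n - 1) * D\<bar>"
    using abs_triangle_ineq by metis
  then show ?thesis unfolding D_def[symmetric] abs_mult by simp
qed

lemma sum_abs_mean_eta_offdiag_le:
  assumes p: "prime n"
  shows "(\<Sum>i\<in>{1..<n}. \<Sum>k\<in>{1..<n} - {i}. \<bar>mean_eta n i k\<bar>)
    \<le> real n / 12 + real n / 4 * (1 + ln (real n))\<^sup>2"
proof -
  have n: "n > 1" using p by (rule prime_gt_1_nat)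
  define D where "D = (\<lambda>i k. \<Sum>z\<in>{1..<n}. B1 (frac (real (i * z) / real n)) * B1 (frac (real (k * z) / real n)))"
  define L where "L = 1 + ln (real n)"
  have row: "(\<Sum>k\<in>{1..<n} - {i}. \<bar>mean_eta n i k\<bar>) \<le> 1 / 12 + 1 / real (n - 1) * (real n / 4 * L\<^sup>2)"
    if i: "i \<in> {1..<n}" for i
  proof -
    have "(\<Sum>k\<in>{1..<n} - {i}. \<bar>mean_eta n i k\<bar>)
        \<le> (\<Sum>k\<in>{1..<n} - {i}. 1 / (12 * real n) + 1 / real (n - 1) * \<bar>D i k\<bar>)"
      unfolding D_def using i by (intro sum_mono abs_mean_eta_offdiag_le[OF p]) auto
    also have "\<dots> \<le> (\<Sum>k\<in>{1..<n}. 1 / (12 * real n) + 1 / real (n - 1) * \<bar>D i k\<bar>)"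
      by (intro sum_mono2) auto
    also have "\<dots> = real (n - 1) / (12 * real n) + 1 / real (n - 1) * (\<Sum>k\<in>{1..<n}. \<bar>D i k\<bar>)"
      unfolding sum.distrib sum_distrib_left[symmetric] by simp
    also have "\<dots> \<le> 1 / 12 + 1 / real (n - 1) * (1 / (4 * real n) * (real n * L)\<^sup>2)"
    proof (intro add_mono mult_left_mono)
      have "(\<Sum>k\<in>{1..<n}. \<bar>D i k\<bar>) \<le> 1 / (4 * real n) * (\<Sum>l\<in>{1..<n}. \<bar>cot (pi * real l / real n)\<bar>)\<^sup>2"
        unfolding D_def by (rule sum_abs_dedekind_le[OF p i])
      also have "\<dots> \<le> 1 / (4 * real n) * (real n * L)\<^sup>2"
        unfolding L_def using n by (intro mult_left_mono power_mono sum_abs_cot_le sum_nonneg) auto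
      finally show "(\<Sum>k\<in>{1..<n}. \<bar>D i k\<bar>) \<le> 1 / (4 * real n) * (real n * L)\<^sup>2" .
    qed (use n in \<open>auto simp: field_simps\<close>)
    also have "1 / (4 * real n) * (real n * L)\<^sup>2 = real n / 4 * L\<^sup>2"
      using n by (simp add: power2_eq_square)
    finally show ?thesis .
  qed
  have "(\<Sum>i\<in>{1..<n}. \<Sum>k\<in>{1..<n} - {i}. \<bar>mean_eta n i k\<bar>)
      \<le> (\<Sum>i\<in>{1..<n}. 1 / 12 + 1 / real (n - 1) * (real n / 4 * L\<^sup>2))"
    by (intro sum_mono row)
  also have "\<dots> = real (n - 1) / 12 + real n / 4 * L\<^sup>2"
  proof -
    have "N * (1 / 12 + 1 / N * x) = N / 12 + x" if "N \<noteq> 0" for N x :: real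
      using that by (simp add: field_simps)
    moreover have "real (n - 1) \<noteq> 0" using n by simp
    ultimately show ?thesis
      unfolding sum_constant card_atLeastLessThan by blast
  qed
  also have "\<dots> \<le> real n / 12 + real n / 4 * L\<^sup>2" by simp
  finally show ?thesis by (simp add: L_def)
qed

text \<open>
  The heart of the bound. The at most \<open>3n\<close> pairs with \<open>i = 0\<close>, \<open>k = 0\<close> or \<open>i = k\<close> are estimated
  trivially by \<open>1/3 ^ m\<close>; they are so few that the factor \<open>1/n\<^sup>2\<close> suffices, and they give the term
  \<open>2/3 ^ m\<close>. For the remaining pairs one factor \<open>mean_eta\<close> is kept and summed, and the other
  \<open>m - 1\<close> factors are at most \<open>1/3\<close>, hence at most \<open>23/24\<close>. The first moment that results is of
  order \<open>(ln n)\<^sup>2/n\<close>, which \<open>ln n \<le> 2 sqrt n\<close> turns into \<open>ln n / sqrt n\<close>.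
\<close>

lemma sum_mean_eta_power_le:
  assumes p: "prime n" and odd: "odd n" and m: "m \<ge> 1"
  shows "1 / (real n)\<^sup>2 * (\<Sum>i<n. \<Sum>k<n. mean_eta n i k ^ m)
    \<le> ln (real n) / sqrt (real n) * (2 / 3 ^ m + 4 * (23/24) ^ m)"
proof -
  have n: "n \<ge> 3" using prime_ge_2_nat[OF p] odd by (cases "n = 2") auto
  define L where "L = ln (real n)"
  define s where "s = sqrt (real n)"
  have ss: "real n = s * s" and s0: "s > 0" using n by (auto simp: s_def)
  have L1: "1 \<le> L"
  proof -
    have "exp 1 \<le> real n" using n exp_le by linarith
    then show ?thesis using n by (simp add: L_def ln_ge_iff)
  qed
  have s32: "3/2 \<le> s"
    unfolding s_def using n by (intro real_le_rsqrt) (simp add: power2_eq_square)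
  have L2: "L \<le> 2 * s"
  proof -
    have "L = 2 * ln s" unfolding L_def s_def using n by (simp add: ln_sqrt)
    also have "ln s \<le> s" using ln_le_minus_one[OF s0] by simp
    finally show ?thesis by simp
  qed
  define q :: real where "q = 23/24"
  define Z where "Z = (\<lambda>i k :: nat. of_bool (i = 0) + of_bool (k = 0) + of_bool (i = k) :: real)"
  define G where "G = (\<lambda>i k. if i \<noteq> 0 \<and> k \<noteq> 0 \<and> k \<noteq> i then \<bar>mean_eta n i k\<bar> else 0)"
  have pt: "mean_eta n i k ^ m \<le> Z i k * (1 / 3 ^ m) + G i k * q ^ (m - 1)" for i k
  proof -
    have "mean_eta n i k ^ m \<le> \<bar>mean_eta n i k\<bar> ^ m" by (metis abs_ge_self power_abs)
    also have "\<dots> \<le> Z i k * (1 / 3 ^ m) + G i k * q ^ (m - 1)"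
    proof (cases "i \<noteq> 0 \<and> k \<noteq> 0 \<and> k \<noteq> i")
      case True
      have "\<bar>mean_eta n i k\<bar> ^ m = \<bar>mean_eta n i k\<bar> * \<bar>mean_eta n i k\<bar> ^ (m - 1)"
        using m by (simp add: power_eq_if)
      also have "\<dots> \<le> \<bar>mean_eta n i k\<bar> * q ^ (m - 1)"
        using abs_mean_eta_le[of n i k] by (intro mult_left_mono power_mono) (auto simp: q_def)
      finally show ?thesis using True by (simp add: Z_def G_def)
    next
      case False
      then have Z: "Z i k \<ge> 1" and G: "G i k = 0" by (auto simp: Z_def G_def)
      have "\<bar>mean_eta n i k\<bar> ^ m \<le> (1/3) ^ m"
        using abs_mean_eta_le[of n i k] by (intro power_mono) auto
      also have "\<dots> = 1 * (1 / 3 ^ m)" by (simp add: power_divide)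
      also have "\<dots> \<le> Z i k * (1 / 3 ^ m)"
        using Z by (intro mult_right_mono) auto
      finally show ?thesis by (simp add: G)
    qed
    finally show ?thesis .
  qed
  have Z: "(\<Sum>i<n. \<Sum>k<n. Z i k) = 3 * real n"
    using n by (simp add: Z_def sum.distrib of_bool_def sum_distrib_left[symmetric])
  have G: "(\<Sum>i<n. \<Sum>k<n. G i k) \<le> real n * (25 / 12 * s * L)"
  proof -
    have ins: "{..<n} = insert 0 {1..<n}" using n by auto
    have "(\<Sum>i<n. \<Sum>k<n. G i k) = (\<Sum>i\<in>{1..<n}. \<Sum>k\<in>{1..<n} - {i}. \<bar>mean_eta n i k\<bar>)"
    proof -
      have "(\<Sum>k<n. G i k) = (\<Sum>k\<in>{1..<n} - {i}. \<bar>mean_eta n i k\<bar>)" if "i \<in> {1..<n}" for i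
      proof -
        have "(\<Sum>k\<in>{1..<n} - {i}. G i k) = (\<Sum>k<n. G i k)"
          by (intro sum.mono_neutral_left) (auto simp: G_def)
        then show ?thesis using that by (simp add: G_def)
      qed
      moreover have "(\<Sum>k<n. G 0 k) = 0" by (simp add: G_def)
      ultimately show ?thesis unfolding ins by simp
    qed
    also have "\<dots> \<le> real n / 12 + real n / 4 * (1 + L)\<^sup>2"
      unfolding L_def by (rule sum_abs_mean_eta_offdiag_le[OF p])
    also have "\<dots> \<le> real n / 12 * (s * L) + real n / 4 * (2 * L)\<^sup>2"
    proof (intro add_mono mult_left_mono power_mono)
      have "1 \<le> s * L" using mult_mono[of 1 s 1 L] s32 L1 by simp
      then show "real n / 12 \<le> real n / 12 * (s * L)"
        using mult_left_mono[of 1 "s * L" "real n / 12"] by simp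
    qed (use L1 in auto)
    also have "real n / 4 * (2 * L)\<^sup>2 = real n * (L * L)" by (simp add: power2_eq_square)
    also have "\<dots> \<le> real n * (2 * s * L)"
      using L1 L2 by (intro mult_left_mono mult_right_mono) auto
    finally show ?thesis by (simp add: algebra_simps)
  qed
  have "(\<Sum>i<n. \<Sum>k<n. mean_eta n i k ^ m)
      \<le> (\<Sum>i<n. \<Sum>k<n. Z i k * (1 / 3 ^ m) + G i k * q ^ (m - 1))"
    by (intro sum_mono pt)
  also have "\<dots> = 3 * real n * (1 / 3 ^ m) + (\<Sum>i<n. \<Sum>k<n. G i k) * q ^ (m - 1)"
    unfolding sum.distrib sum_distrib_right[symmetric] Z ..
  also have "\<dots> \<le> (2 * s * L * real n) * (1 / 3 ^ m) + real n * (25 / 12 * s * L) * q ^ (m - 1)"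
  proof (intro add_mono mult_right_mono G)
    have "3 * 1 \<le> (2 * s) * L" using L1 s32 by (intro mult_mono) auto
    then show "3 \<le> 2 * s * L" by simp
  qed (auto simp: q_def)
  also have "\<dots> \<le> (2 * s * L * real n) * (1 / 3 ^ m) + real n * (4 * q * s * L) * q ^ (m - 1)"
    using s0 L1 by (intro add_mono mult_right_mono mult_left_mono) (auto simp: q_def)
  also have "\<dots> = real n * s * L * (2 / 3 ^ m + 4 * (q * q ^ (m - 1)))"
    by (simp add: algebra_simps)
  also have "q * q ^ (m - 1) = q ^ m" using m by (simp add: power_eq_if)
  finally have "1 / (real n)\<^sup>2 * (\<Sum>i<n. \<Sum>k<n. mean_eta n i k ^ m)
     \<le> 1 / (real n)\<^sup>2 * (real n * s * L * (2 / 3 ^ m + 4 * q ^ m))"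
    by (intro mult_left_mono) auto
  also have "\<dots> = L / s * (2 / 3 ^ m + 4 * q ^ m)"
    unfolding ss using s0 by (simp add: power2_eq_square)
  finally show ?thesis by (simp add: L_def s_def q_def)
qed

section \<open>The error functional on a reproducing kernel Hilbert space\<close>

context hilbert_function_space
begin

lemma ip_add_right: "f \<in> H \<Longrightarrow> g \<in> H \<Longrightarrow> h \<in> H \<Longrightarrow> ip h (\<lambda>x. f x + g x) = ip h f + ip h g"
  using ip_add_left[of f g h] ip_commute[of h] add_mem[of f g] by metis

lemma ip_scale_right: "f \<in> H \<Longrightarrow> g \<in> H \<Longrightarrow> ip f (\<lambda>x. c * g x) = c * ip f g"
  using ip_scale_left[of g f c] ip_commute[of f] scale_mem[of g c] by metis

lemma ip_add_scaled_self:
  assumes "f \<in> H" "g \<in> H"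
  shows "ip (\<lambda>x. f x + c * g x) (\<lambda>x. f x + c * g x) = ip f f + 2 * c * ip f g + c\<^sup>2 * ip g g"
  using assms ip_commute[of f g]
  by (simp add: ip_add_left ip_add_right ip_scale_left ip_scale_right add_mem scale_mem
      power2_eq_square algebra_simps)

lemma Cauchy_Schwarz:
  assumes "f \<in> H" "g \<in> H"
  shows "(ip f g)\<^sup>2 \<le> ip f f * ip g g"
proof (cases "ip g g = 0")
  case True
  then have "g = (\<lambda>_. 0)" using assms ip_definite by blast
  then have "ip f g = 0" using ip_scale_right[OF assms(1) assms(1), of 0] by simp
  with True show ?thesis by simp
next
  case False
  define c where "c = - ip f g / ip g g"
  have pos: "ip g g > 0" using False ip_nonneg[OF assms(2)] by simp
  have "0 \<le> ip f f + 2 * c * ip f g + c\<^sup>2 * ip g g"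
    unfolding ip_add_scaled_self[OF assms, symmetric] using assms by (intro ip_nonneg add_mem scale_mem)
  also have "\<dots> = ip f f - (ip f g)\<^sup>2 / ip g g"
    using pos by (simp add: c_def power2_eq_square field_simps)
  finally show ?thesis using pos by (simp add: field_simps)
qed

lemma sum_mem: "(\<And>i. i \<in> A \<Longrightarrow> f i \<in> H) \<Longrightarrow> (\<lambda>x. \<Sum>i\<in>A. f i x) \<in> H"
  by (induction A rule: infinite_finite_induct) (auto intro: zero_mem add_mem)

lemma ip_sum_right: "(\<And>i. i \<in> A \<Longrightarrow> f i \<in> H) \<Longrightarrow> g \<in> H \<Longrightarrow> ip g (\<lambda>x. \<Sum>i\<in>A. f i x) = (\<Sum>i\<in>A. ip g (f i))"
proof (induction A rule: infinite_finite_induct)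
  case (insert i A)
  then show ?case using ip_add_right[of "f i" "\<lambda>x. \<Sum>i\<in>A. f i x" g] by (simp add: sum_mem)
qed (use ip_scale_right[of g g 0] in simp_all)

end

context rkhs
begin

lemma ip_kernel_kernel: "x \<in> X \<Longrightarrow> y \<in> X \<Longrightarrow> ip (kernel_section X K x) (kernel_section X K y) = K y x"
  using reproducing[OF kernel_mem, of x y] by (simp add: kernel_section_def)

lemma kernel_commute: "x \<in> X \<Longrightarrow> y \<in> X \<Longrightarrow> K x y = K y x"
  using ip_kernel_kernel ip_commute kernel_mem by metis

lemma power2_le_diag: "f \<in> H \<Longrightarrow> x \<in> X \<Longrightarrow> (f x)\<^sup>2 \<le> ip f f * K x x"
  using Cauchy_Schwarz[OF _ kernel_mem, of f x] by (simp add: reproducing ip_kernel_kernel)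

text \<open>
  The distance between two kernel sections bounds the oscillation of every element; continuity of the
  kernel thus passes to the whole space.
\<close>

lemma power2_diff_le:
  assumes "f \<in> H" "x \<in> X" "y \<in> X"
  shows "(f y - f x)\<^sup>2 \<le> ip f f * (K y y - 2 * K y x + K x x)"
proof -
  let ?k = "kernel_section X K"
  let ?h = "\<lambda>z. ?k y z + (-1) * ?k x z"
  have k: "?k x \<in> H" "?k y \<in> H" using assms kernel_mem by auto
  have "?h \<in> H" by (intro add_mem scale_mem k)
  moreover have "ip f ?h = f y - f x"
    using assms k ip_add_right[OF k(2) scale_mem[OF k(1), of "-1"] assms(1)] ip_scale_right[OF assms(1) k(1), of "-1"]
    by (simp add: reproducing)
  moreover have "ip ?h ?h = K y y - 2 * K y x + K x x"
    using assms kernel_commute[of x y] by (simp only: ip_add_scaled_self[OF k(2,1)] ip_kernel_kernel) simp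
  ultimately show ?thesis using Cauchy_Schwarz[OF assms(1), of ?h] by metis
qed

lemma integrable_mem:
  assumes fin: "finite_measure M" and sp: "space M = X" and meas: "h \<in> borel_measurable M"
    and diag: "\<And>y. y \<in> X \<Longrightarrow> K y y \<le> R" and h: "h \<in> H"
  shows "integrable M h"
proof (rule finite_measure.integrable_const_bound[OF fin, where B = "sqrt (ip h h * R)"])
  show "AE x in M. norm (h x) \<le> sqrt (ip h h * R)"
  proof (rule AE_I2)
    fix x assume "x \<in> space M"
    then have x: "x \<in> X" using sp by simp
    have "(h x)\<^sup>2 \<le> ip h h * R"
      using power2_le_diag[OF h x] mult_left_mono[OF diag[OF x] ip_nonneg[OF h]] by linarith
    then show "norm (h x) \<le> sqrt (ip h h * R)"
      using real_le_rsqrt[of "\<bar>h x\<bar>"] by simp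
  qed
qed (rule meas)

text \<open>
  If the integral were represented by some \<open>h \<in> H\<close>, this would be the Cauchy--Schwarz inequality for
  \<open>h + g\<close>, with \<open>\<langle>h, h\<rangle> = \<kappa>\<close> and \<open>\<langle>h, g\<rangle> = \<integral>g\<close>. To avoid constructing \<open>h\<close>, the integral is
  replaced by the mean of \<open>f\<close> over \<open>N\<close> independent random points: Cauchy--Schwarz holds for each
  sample, and taking expectations costs an error of order \<open>1/N\<close>. The expectation is taken one point at
  a time, by induction on the number of points that are already integrated out, so that no measure on
  samples is needed.
\<close>

lemma integral_functional_bound:
  fixes M :: "'a measure" and \<kappa> R :: real
  assumes fin: "finite_measure M" and one: "measure M (space M) = 1" and sp: "space M = X"
    and meas: "\<And>h. h \<in> H \<Longrightarrow> h \<in> borel_measurable M"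
    and diag_meas: "(\<lambda>y. K y y) \<in> borel_measurable M"
    and diag: "\<And>y. y \<in> X \<Longrightarrow> K y y \<le> R"
    and mean: "\<And>y. y \<in> X \<Longrightarrow> (\<integral>x. K x y \<partial>M) = \<kappa>"
    and f: "f \<in> H" and g: "g \<in> H"
  shows "((\<integral>x. f x \<partial>M) + ip f g)\<^sup>2 \<le> ip f f * (\<kappa> + 2 * (\<integral>x. g x \<partial>M) + ip g g)"
proof -
  interpret finite_measure M by fact
  let ?k = "kernel_section X K"
  define I where "I = (\<lambda>h :: 'a \<Rightarrow> real. \<integral>x. h x \<partial>M)"
  define \<rho> where "\<rho> = (\<integral>y. K y y \<partial>M)"
  have diag0: "0 \<le> K y y" if "y \<in> X" for y
    using ip_nonneg[OF kernel_mem[OF that]] ip_kernel_kernel[OF that that] by simp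
  have intH: "integrable M h" if "h \<in> H" for h
    by (rule integrable_mem[OF fin sp meas[OF that] diag that])
  have int_diag: "integrable M (\<lambda>y. K y y)"
    by (rule integrable_const_bound[where B = R])
       (use diag diag0 sp diag_meas in \<open>auto intro!: AE_I2\<close>)
  have Ik: "I (?k y) = \<kappa>" if y: "y \<in> X" for y
  proof -
    have "I (?k y) = (\<integral>x. K x y \<partial>M)"
      unfolding I_def by (rule Bochner_Integration.integral_cong) (auto simp: kernel_section_def sp)
    then show ?thesis using mean[OF y] by simp
  qed
  have key: "(real N * s * I f + ip f g)\<^sup>2 \<le>
      ip f f * (((real N)\<^sup>2 - real N) * s\<^sup>2 * \<kappa> + real N * s\<^sup>2 * \<rho> + 2 * real N * s * I g + ip g g)"
    if "g \<in> H" for N s g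
    using that
  proof (induction N arbitrary: g)
    case 0
    then show ?case using Cauchy_Schwarz[OF f] by simp
  next
    case (Suc N)
    note g = Suc.prems
    define A where "A = real N * s * I f + ip f g"
    define B where "B = ((real N)\<^sup>2 - real N) * s\<^sup>2 * \<kappa> + real N * s\<^sup>2 * \<rho> + 2 * real N * s * (I g + s * \<kappa>) + ip g g"
    define m where "m = A + s * I f"
    \<comment> \<open>Jensen in tangent form: bounding the square from below by its tangent at the mean keeps the left-hand side affine in \<open>f y\<close>.\<close>
    have pt: "2 * m * (A + s * f y) - m\<^sup>2 \<le> ip f f * (B + 2 * s * g y + s\<^sup>2 * K y y)"
      if y: "y \<in> X" for y
    proof -
      note k = kernel_mem[OF y]
      let ?g = "\<lambda>x. g x + s * ?k y x"
      have gH: "?g \<in> H" using g k by (intro add_mem scale_mem)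
      have "I ?g = I g + s * \<kappa>"
        using intH[OF g] intH[OF k] Ik[OF y] by (simp add: I_def)
      moreover have "ip f ?g = ip f g + s * f y"
        using f g k y by (simp add: ip_add_right ip_scale_right scale_mem reproducing)
      moreover have "ip ?g ?g = ip g g + 2 * s * g y + s\<^sup>2 * K y y"
        by (simp only: ip_add_scaled_self[OF g k] ip_kernel_kernel[OF y y] reproducing[OF g y])
      ultimately have "(A + s * f y)\<^sup>2 \<le> ip f f * (B + 2 * s * g y + s\<^sup>2 * K y y)"
        using Suc.IH[OF gH] by (simp add: A_def B_def add.assoc)
      moreover have "0 \<le> (A + s * f y - m)\<^sup>2" by simp
      ultimately show ?thesis by (simp add: power2_diff algebra_simps)
    qed
    have "(\<integral>y. 2 * m * (A + s * f y) - m\<^sup>2 \<partial>M) \<le> (\<integral>y. ip f f * (B + 2 * s * g y + s\<^sup>2 * K y y) \<partial>M)"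
      using pt sp intH[OF f] intH[OF g] int_diag by (intro integral_mono) auto
    also have "(\<integral>y. 2 * m * (A + s * f y) - m\<^sup>2 \<partial>M) = 2 * m * (A + s * I f) - m\<^sup>2"
      using intH[OF f] one by (simp add: I_def)
    also have "\<dots> = (real (Suc N) * s * I f + ip f g)\<^sup>2"
      by (simp add: m_def A_def power2_eq_square algebra_simps)
    also have "(\<integral>y. ip f f * (B + 2 * s * g y + s\<^sup>2 * K y y) \<partial>M) = ip f f * (B + 2 * s * I g + s\<^sup>2 * \<rho>)"
      using intH[OF g] int_diag one by (simp add: I_def \<rho>_def)
    also have "B + 2 * s * I g + s\<^sup>2 * \<rho> = ((real (Suc N))\<^sup>2 - real (Suc N)) * s\<^sup>2 * \<kappa> + real (Suc N) * s\<^sup>2 * \<rho> + 2 * real (Suc N) * s * I g + ip g g"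
      by (simp add: B_def power2_eq_square algebra_simps)
    finally show ?case .
  qed
  have "(I f + ip f g)\<^sup>2 \<le> ip f f * (\<kappa> + inverse (real (Suc N)) * (\<rho> - \<kappa>) + 2 * I g + ip g g)" for N
  proof -
    have "(a\<^sup>2 - a) * s\<^sup>2 * \<kappa> + a * s\<^sup>2 * \<rho> + 2 * a * s * I g + ip g g = \<kappa> + s * (\<rho> - \<kappa>) + 2 * I g + ip g g"
      if "a * s = 1" for a s :: real
    proof -
      have "(a\<^sup>2 - a) * s\<^sup>2 * \<kappa> + a * s\<^sup>2 * \<rho> + 2 * a * s * I g
          = (a * s) * (a * s) * \<kappa> - (a * s) * s * \<kappa> + (a * s) * s * \<rho> + 2 * (a * s) * I g"
        by (simp add: power2_eq_square algebra_simps)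
      then show ?thesis using that by (simp add: algebra_simps)
    qed
    moreover have "real (Suc N) * inverse (real (Suc N)) = 1" by (simp del: of_nat_Suc)
    ultimately show ?thesis
      using key[OF g, of "Suc N" "inverse (real (Suc N))"] by (metis mult_1)
  qed
  moreover have "(\<lambda>N. ip f f * (\<kappa> + inverse (real (Suc N)) * (\<rho> - \<kappa>) + 2 * I g + ip g g))
      \<longlonglongrightarrow> ip f f * (\<kappa> + 0 * (\<rho> - \<kappa>) + 2 * I g + ip g g)"
    by (intro tendsto_intros LIMSEQ_inverse_real_of_nat)
  ultimately have "(I f + ip f g)\<^sup>2 \<le> ip f f * (\<kappa> + 0 * (\<rho> - \<kappa>) + 2 * I g + ip g g)"
    by (intro LIMSEQ_le_const) auto
  then show ?thesis by (simp add: I_def)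
qed

text \<open>
  The quadrature rule is represented by an average of kernel sections; its negative is the \<open>g\<close> of
  \<open>integral_functional_bound\<close>.
\<close>

lemma quadrature_error_bound:
  fixes M :: "'a measure" and \<kappa> R :: real and p :: "nat \<Rightarrow> 'a"
  assumes fin: "finite_measure M" and one: "measure M (space M) = 1" and sp: "space M = X"
    and meas: "\<And>h. h \<in> H \<Longrightarrow> h \<in> borel_measurable M"
    and diag_meas: "(\<lambda>y. K y y) \<in> borel_measurable M"
    and diag: "\<And>y. y \<in> X \<Longrightarrow> K y y \<le> R"
    and mean: "\<And>y. y \<in> X \<Longrightarrow> (\<integral>x. K x y \<partial>M) = \<kappa>"
    and f: "f \<in> H" and p: "\<And>i. i < n \<Longrightarrow> p i \<in> X" and n: "n > 0"
  shows "((\<integral>x. f x \<partial>M) - 1 / real n * (\<Sum>i<n. f (p i)))\<^sup>2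
    \<le> ip f f * (1 / (real n)\<^sup>2 * (\<Sum>i<n. \<Sum>k<n. K (p i) (p k)) - \<kappa>)"
proof -
  let ?k = "kernel_section X K"
  define g where "g = (\<lambda>x. \<Sum>i<n. - (1 / real n) * ?k (p i) x)"
  have kp: "(\<lambda>x. - (1 / real n) * ?k (p i) x) \<in> H" if "i \<in> {..<n}" for i
    using that p by (intro scale_mem kernel_mem) auto
  have g: "g \<in> H" unfolding g_def by (intro sum_mem kp)
  have ipg: "ip h g = - (1 / real n) * (\<Sum>i<n. h (p i))" if h: "h \<in> H" for h
  proof -
    have "ip h g = (\<Sum>i<n. ip h (\<lambda>x. - (1 / real n) * ?k (p i) x))"
      unfolding g_def by (rule ip_sum_right[OF kp h])
    also have "\<dots> = (\<Sum>i<n. - (1 / real n) * h (p i))"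
      using h p by (intro sum.cong refl) (simp only: ip_scale_right kernel_mem reproducing lessThan_iff)
    finally show ?thesis by (simp only: sum_distrib_left)
  qed
  have "ip g g = 1 / (real n)\<^sup>2 * (\<Sum>i<n. \<Sum>k<n. K (p i) (p k))"
  proof -
    have gp: "g (p i) = - (1 / real n) * (\<Sum>k<n. K (p i) (p k))" if "i < n" for i
      using p[OF that] by (simp add: g_def kernel_section_def sum_distrib_left)
    have "ip g g = - (1 / real n) * (\<Sum>i<n. - (1 / real n) * (\<Sum>k<n. K (p i) (p k)))"
    proof -
      have "(\<Sum>i<n. g (p i)) = (\<Sum>i<n. - (1 / real n) * (\<Sum>k<n. K (p i) (p k)))"
        by (intro sum.cong refl gp) simp
      then show ?thesis by (simp only: ipg[OF g])
    qed
    also have "\<dots> = 1 / (real n)\<^sup>2 * (\<Sum>i<n. \<Sum>k<n. K (p i) (p k))"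
      unfolding sum_distrib_left[symmetric] by (simp add: power2_eq_square)
    finally show ?thesis .
  qed
  moreover have "(\<integral>x. g x \<partial>M) = - \<kappa>"
  proof -
    have "(\<integral>x. g x \<partial>M) = (\<Sum>i<n. \<integral>x. - (1 / real n) * ?k (p i) x \<partial>M)"
      unfolding g_def
    proof (rule Bochner_Integration.integral_sum)
      fix i assume "i \<in> {..<n}"
      then have "(\<lambda>x. - (1 / real n) * ?k (p i) x) \<in> H" by (rule kp)
      then show "integrable M (\<lambda>x. - (1 / real n) * ?k (p i) x)"
        by (intro integrable_mem[OF fin sp meas diag])
    qed
    also have "\<dots> = (\<Sum>i<n. - (1 / real n) * \<kappa>)"
    proof (intro sum.cong refl)
      fix i assume "i \<in> {..<n}"
      then have "p i \<in> X" using p by simp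
      moreover have "(\<integral>x. ?k (p i) x \<partial>M) = (\<integral>x. K x (p i) \<partial>M)"
        by (rule Bochner_Integration.integral_cong) (auto simp: kernel_section_def sp)
      ultimately show "(\<integral>x. - (1 / real n) * ?k (p i) x \<partial>M) = - (1 / real n) * \<kappa>"
        using mean by simp
    qed
    also have "\<dots> = - \<kappa>" using n by simp
    finally show ?thesis .
  qed
  ultimately show ?thesis
    using integral_functional_bound[OF fin one sp meas diag_meas diag mean f g] ipg[OF f] by simp
qed

end

lemma rkhs_continuous_on:
  fixes X :: "'a::topological_space set"
  assumes r: "rkhs X K H ip" and f: "f \<in> H"
    and diag: "continuous_on X (\<lambda>x. K x x)"
    and sec: "\<And>y. y \<in> X \<Longrightarrow> continuous_on X (\<lambda>x. K x y)"
  shows "continuous_on X f"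
  unfolding continuous_on_def
proof
  interpret rkhs X K H ip by fact
  fix x assume x: "x \<in> X"
  define \<phi> where "\<phi> = (\<lambda>y. sqrt (ip f f * (K y y - 2 * K y x + K x x)))"
  have "(\<phi> \<longlongrightarrow> sqrt (ip f f * (K x x - 2 * K x x + K x x))) (at x within X)"
    unfolding \<phi>_def using diag sec[OF x] x by (intro tendsto_intros) (auto simp: continuous_on_def)
  then have \<phi>: "(\<phi> \<longlongrightarrow> 0) (at x within X)" by simp
  have "((\<lambda>y. f y - f x) \<longlongrightarrow> 0) (at x within X)"
  proof (rule Lim_null_comparison[OF _ \<phi>])
    show "\<forall>\<^sub>F y in at x within X. norm (f y - f x) \<le> \<phi> y"
      unfolding eventually_at_topological \<phi>_def
      using power2_diff_le[OF f x] real_le_rsqrt[of "\<bar>f _ - f x\<bar>"] by (intro exI[of _ UNIV]) auto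
  qed
  then show "(f \<longlongrightarrow> f x) (at x within X)" by (simp add: LIM_zero_iff)
qed

section \<open>The cube and the worst-case error of a lattice rule\<close>

lemma continuous_on_eta [continuous_intros]:
  "continuous_on A f \<Longrightarrow> continuous_on A g \<Longrightarrow> continuous_on A (\<lambda>x. eta (f x) (g x))"
  unfolding eta_def B1_def B2_def by (intro continuous_intros) auto

text \<open>
  Because of this vanishing mean, every term of the kernel except the one for \<open>u = {}\<close> integrates to
  zero.
\<close>

lemma integral_eta:
  assumes y: "y \<in> {0..<1}"
  shows "(\<integral>x. indicator {0..<1} x * eta x y \<partial>lborel) = 0"
proof -
  have cont: "continuous_on A (\<lambda>x. eta x y)" for A by (intro continuous_intros)
  have "(\<integral>x. indicator {0..<1} x * eta x y \<partial>lborel) = (\<integral>x. indicator {0..1} x * eta x y \<partial>lborel)"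
  proof (rule integral_cong_AE)
    show "AE x in lborel. indicator {0..<1} x * eta x y = indicator {0..1} x * eta x y"
      using AE_lborel_singleton[of "1::real"] by eventually_elim (auto simp: indicator_def)
    have "(\<lambda>x. eta x y) \<in> borel_measurable lborel"
      using borel_measurable_continuous_onI[OF cont] by simp
    then show "(\<lambda>x. indicator {0..<1} x * eta x y) \<in> borel_measurable lborel"
      "(\<lambda>x. indicator {0..1} x * eta x y) \<in> borel_measurable lborel" by measurable
  qed
  also have "\<dots> = (LINT x:{0..1}|lborel. eta x y)"
    by (simp add: set_lebesgue_integral_def)
  also have "\<dots> = integral {0..1} (\<lambda>x. eta x y)"
    by (intro set_borel_integral_eq_integral borel_integrable_atLeastAtMost' cont)
  also have "\<dots> = 0"
  proof (rule integral_unique)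
    have left: "((\<lambda>x. eta x y) has_integral (y/3 - y*y + (y^3/3 + y * y\<^sup>2)/2)) {0..y}"
    proof -
      have "((\<lambda>x. 1/3 - y + (x\<^sup>2 + y\<^sup>2)/2) has_integral
          ((y/3 - y*y + (y^3/3 + y * y\<^sup>2)/2) - (0/3 - y*0 + (0^3/3 + 0 * y\<^sup>2)/2))) {0..y}"
        using y by (intro fundamental_theorem_of_calculus)
          (auto intro!: derivative_eq_intros simp flip: has_real_derivative_iff_has_vector_derivative)
      then show ?thesis
        by (subst has_integral_cong[where g = "\<lambda>x. 1/3 - y + (x\<^sup>2 + y\<^sup>2)/2"]) (auto simp: eta_altdef max_def)
    qed
    have right: "((\<lambda>x. eta x y) has_integral ((1/3 - 1/2 + (1/3 + y\<^sup>2)/2) - (y/3 - y\<^sup>2/2 + (y^3/3 + y * y\<^sup>2)/2))) {y..1}"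
    proof -
      have "((\<lambda>x. 1/3 - x + (x\<^sup>2 + y\<^sup>2)/2) has_integral
          ((1/3 - 1\<^sup>2/2 + (1^3/3 + 1 * y\<^sup>2)/2) - (y/3 - y\<^sup>2/2 + (y^3/3 + y * y\<^sup>2)/2))) {y..1}"
        using y by (intro fundamental_theorem_of_calculus)
          (auto intro!: derivative_eq_intros simp flip: has_real_derivative_iff_has_vector_derivative)
      then show ?thesis
        by (subst has_integral_cong[where g = "\<lambda>x. 1/3 - x + (x\<^sup>2 + y\<^sup>2)/2"]) (auto simp: eta_altdef max_def)
    qed
    have "((\<lambda>x. eta x y) has_integral (y/3 - y*y + (y^3/3 + y * y\<^sup>2)/2)
        + ((1/3 - 1/2 + (1/3 + y\<^sup>2)/2) - (y/3 - y\<^sup>2/2 + (y^3/3 + y * y\<^sup>2)/2))) {0..1}"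
      using y by (intro has_integral_combine[OF _ _ left right]) auto
    then show "((\<lambda>x. eta x y) has_integral 0) {0..1}"
      by (simp add: power2_eq_square field_simps)
  qed
  finally show ?thesis .
qed

abbreviation cube_borel :: "nat \<Rightarrow> (nat \<Rightarrow> real) measure" where
  "cube_borel d \<equiv> (\<Pi>\<^sub>M j\<in>{1..d}. lborel)"

definition cube_measure :: "nat \<Rightarrow> (nat \<Rightarrow> real) measure" where
  "cube_measure d = restrict_space (cube_borel d) (unit_cube d)"

lemma unit_cube_sets: "unit_cube d \<in> sets (cube_borel d)"
  unfolding unit_cube_def by (intro sets_PiM_I_finite) auto

lemma space_cube_measure: "space (cube_measure d) = unit_cube d"
  using sets.sets_into_space[OF unit_cube_sets] by (auto simp: cube_measure_def space_restrict_space)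

interpretation lborel_product: product_sigma_finite "\<lambda>_::nat. lborel :: real measure"
  by standard

lemma emeasure_cube_measure: "emeasure (cube_measure d) (space (cube_measure d)) = 1"
proof -
  have "emeasure (cube_borel d) (unit_cube d) = (\<Prod>j\<in>{1..d}. emeasure lborel {0..<1::real})"
    unfolding unit_cube_def by (intro lborel_product.emeasure_PiM) auto
  then show ?thesis
    unfolding space_cube_measure using unit_cube_sets[of d]
    by (simp add: cube_measure_def emeasure_restrict_space)
qed

lemma finite_measure_cube_measure: "finite_measure (cube_measure d)"
  by (rule finite_measureI) (simp add: emeasure_cube_measure)

lemma cube_integral_eq: "cube_integral d f = (\<integral>x. f x \<partial>cube_measure d)"
  using unit_cube_sets[of d]
  by (simp add: cube_integral_def cube_measure_def integral_restrict_space set_lebesgue_integral_def)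

lemma continuous_on_imp_measurable_cube:
  assumes "continuous_on (unit_cube d) f"
  shows "f \<in> borel_measurable (cube_measure d)"
proof -
  have "(\<lambda>x. x) \<in> measurable (cube_borel d) (borel :: (nat \<Rightarrow> real) measure)"
  proof (rule measurable_coordinatewise_then_product)
    fix j
    show "(\<lambda>x. x j) \<in> borel_measurable (cube_borel d)"
    proof (cases "j \<in> {1..d}")
      case True
      then show ?thesis using measurable_component_singleton[of j "{1..d}" "\<lambda>_. lborel"] by simp
    next
      case False
      then have "(\<lambda>x. x j) \<in> borel_measurable (cube_borel d) \<longleftrightarrow> (\<lambda>x. undefined :: real) \<in> borel_measurable (cube_borel d)"
        by (intro measurable_cong) (auto simp: space_PiM PiE_def extensional_def)
      then show ?thesis by simp
    qed
  qed
  then have "(\<lambda>x. x) \<in> measurable (cube_measure d) (restrict_space borel (unit_cube d))"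
    unfolding cube_measure_def by (intro measurable_restrict_space3) auto
  moreover have "f \<in> borel_measurable (restrict_space borel (unit_cube d))"
    using assms by (rule borel_measurable_continuous_on_restrict)
  ultimately show ?thesis using measurable_comp by fastforce
qed

lemma continuous_on_coordinate: "continuous_on A (\<lambda>x :: nat \<Rightarrow> real. x j)"
  by (rule continuous_on_subset[OF continuous_on_product_coordinates]) simp

lemma abs_prod_eta_le_1:
  assumes "x \<in> unit_cube d" "y \<in> unit_cube d" "u \<subseteq> {1..d}"
  shows "\<bar>\<Prod>j\<in>u. eta (x j) (y j)\<bar> \<le> 1"
  unfolding abs_prod
proof (rule prod_le_1)
  fix j assume "j \<in> u"
  then have "x j \<in> {0..<1}" "y j \<in> {0..<1}"
    using assms unfolding unit_cube_def by (blast dest: PiE_mem)+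
  from abs_eta_le[OF this] show "0 \<le> \<bar>eta (x j) (y j)\<bar> \<and> \<bar>eta (x j) (y j)\<bar> \<le> 1" by simp
qed

lemma integral_prod_eta:
  assumes y: "y \<in> unit_cube d" and u: "u \<subseteq> {1..d}"
  shows "(\<integral>x. (\<Prod>j\<in>u. eta (x j) (y j)) \<partial>cube_measure d) = of_bool (u = {})"
proof -
  define F where "F = (\<lambda>j t. indicator {0..<1} t * (if j \<in> u then eta t (y j) else 1))"
  have yj: "y j \<in> {0..<1}" if "j \<in> {1..d}" for j
    using y that unfolding unit_cube_def by (blast dest: PiE_mem)
  have intF: "integrable lborel (F j)" if j: "j \<in> {1..d}" for j
  proof (rule Bochner_Integration.integrable_bound)
    show "integrable lborel (indicator {0..<1} :: real \<Rightarrow> real)" by simp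
    have "(\<lambda>t. eta t (y j)) \<in> borel_measurable borel"
      by (intro borel_measurable_continuous_onI continuous_intros)
    then show "F j \<in> borel_measurable lborel" unfolding F_def by simp
    show "AE t in lborel. norm (F j t) \<le> norm (indicator {0..<1} t :: real)"
      using abs_eta_le[OF _ yj[OF j]] by (intro AE_I2) (fastforce simp: F_def indicator_def)
  qed
  have "(\<integral>x. (\<Prod>j\<in>u. eta (x j) (y j)) \<partial>cube_measure d)
      = (\<integral>x. indicator (unit_cube d) x * (\<Prod>j\<in>u. eta (x j) (y j)) \<partial>cube_borel d)"
    using unit_cube_sets[of d] by (simp add: cube_measure_def integral_restrict_space)
  also have "\<dots> = (\<integral>x. (\<Prod>j\<in>{1..d}. F j (x j)) \<partial>cube_borel d)"
  proof (rule Bochner_Integration.integral_cong)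
    fix x assume "x \<in> space (cube_borel d)"
    then have ext: "x \<in> extensional {1..d}" by (simp add: space_PiM PiE_def)
    have "(\<Prod>j\<in>{1..d}. if j \<in> u then eta (x j) (y j) else 1) = (\<Prod>j\<in>u. eta (x j) (y j))"
      using u by (simp add: prod.If_cases Int_absorb1)
    moreover have "(\<Prod>j\<in>{1..d}. indicator {0..<1} (x j) :: real) = indicator (unit_cube d) x"
    proof (cases "x \<in> unit_cube d")
      case True
      then have "\<And>j. j \<in> {1..d} \<Longrightarrow> x j \<in> {0..<1}" unfolding unit_cube_def by (blast dest: PiE_mem)
      then have "(\<Prod>j\<in>{1..d}. indicator {0..<1} (x j) :: real) = (\<Prod>j\<in>{1..d}. 1)"
        by (intro prod.cong refl) simp
      then show ?thesis using True by simp
    next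
      case False
      then obtain j where "j \<in> {1..d}" "x j \<notin> {0..<1}"
        using ext unfolding unit_cube_def by (auto simp: PiE_def Pi_def)
      then have "(\<Prod>j\<in>{1..d}. indicator {0..<1} (x j) :: real) = 0"
        by (intro prod_zero) (auto simp: indicator_def intro: bexI[of _ j])
      then show ?thesis using False by simp
    qed
    ultimately show "indicator (unit_cube d) x * (\<Prod>j\<in>u. eta (x j) (y j)) = (\<Prod>j\<in>{1..d}. F j (x j))"
      by (simp add: F_def prod.distrib)
  qed simp
  also have "\<dots> = (\<Prod>j\<in>{1..d}. \<integral>t. F j t \<partial>lborel)"
    using intF by (intro lborel_product.product_integral_prod) auto
  also have "\<dots> = of_bool (u = {})"
  proof (cases "u = {}")
    case True
    then show ?thesis by (simp add: F_def)
  next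
    case False
    then obtain j where j: "j \<in> u" by blast
    then have "(\<integral>t. F j t \<partial>lborel) = 0" using integral_eta[OF yj] u by (auto simp: F_def)
    then show ?thesis using j u False by (auto simp: prod_zero_iff)
  qed
  finally show ?thesis .
qed

lemma sobolev_kernel_mean:
  assumes y: "y \<in> unit_cube d"
  shows "(\<integral>x. sobolev_kernel d \<gamma> x y \<partial>cube_measure d) = \<gamma> {}"
proof -
  interpret finite_measure "cube_measure d" by (rule finite_measure_cube_measure)
  have int: "integrable (cube_measure d) (\<lambda>x. \<Prod>j\<in>u. eta (x j) (y j))" if "u \<in> Pow {1..d}" for u
  proof (rule integrable_const_bound[where B = 1])
    show "AE x in cube_measure d. norm (\<Prod>j\<in>u. eta (x j) (y j)) \<le> 1"
      using abs_prod_eta_le_1[OF _ y] that by (intro AE_I2) (auto simp: space_cube_measure)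
    show "(\<lambda>x. \<Prod>j\<in>u. eta (x j) (y j)) \<in> borel_measurable (cube_measure d)"
      by (intro continuous_on_imp_measurable_cube continuous_intros continuous_on_coordinate)
  qed
  have "(\<integral>x. sobolev_kernel d \<gamma> x y \<partial>cube_measure d)
      = (\<Sum>u\<in>Pow {1..d}. \<integral>x. \<gamma> u * (\<Prod>j\<in>u. eta (x j) (y j)) \<partial>cube_measure d)"
    unfolding sobolev_kernel_def by (intro Bochner_Integration.integral_sum integrable_mult_right int)
  also have "\<dots> = (\<Sum>u\<in>Pow {1..d}. \<gamma> u * of_bool (u = {}))"
    using integral_prod_eta[OF y] by (intro sum.cong refl) auto
  also have "\<dots> = \<gamma> {}" by (simp add: of_bool_def if_distrib cong: if_cong)
  finally show ?thesis .
qed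

lemma lattice_point_in_cube: "lattice_point d n z i \<in> unit_cube d"
  by (auto simp: lattice_point_def unit_cube_def frac_lt_1)

text \<open>
  The square, not the value, of the worst-case error; the term of the kernel for \<open>u = {}\<close> is missing
  because constants are integrated exactly.
\<close>

definition lattice_error :: "nat \<Rightarrow> (nat set \<Rightarrow> real) \<Rightarrow> nat \<Rightarrow> (nat \<Rightarrow> nat) \<Rightarrow> real" where
  "lattice_error d \<gamma> n z = (\<Sum>u\<in>Pow {1..d} - {{}}. \<gamma> u * (1 / (real n)\<^sup>2 * (\<Sum>i<n. \<Sum>k<n.
     \<Prod>j\<in>u. eta (frac (real i * real (z j) / real n)) (frac (real k * real (z j) / real n)))))"

lemma sum_kernel_lattice:
  assumes n: "n > 0"
  shows "1 / (real n)\<^sup>2 * (\<Sum>i<n. \<Sum>k<n. sobolev_kernel d \<gamma> (lattice_point d n z i) (lattice_point d n z k)) - \<gamma> {}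
    = lattice_error d \<gamma> n z"
proof -
  define P where "P = (\<lambda>u i k. \<Prod>j\<in>u. eta (frac (real i * real (z j) / real n)) (frac (real k * real (z j) / real n)))"
  have K: "sobolev_kernel d \<gamma> (lattice_point d n z i) (lattice_point d n z k) = (\<Sum>u\<in>Pow {1..d}. \<gamma> u * P u i k)" for i k
    unfolding sobolev_kernel_def P_def lattice_point_def
    by (intro sum.cong refl arg_cong2[where f = "(*)"] prod.cong) auto
  have "(\<Sum>i<n. \<Sum>k<n. \<Sum>u\<in>Pow {1..d}. \<gamma> u * P u i k) = (\<Sum>i<n. \<Sum>u\<in>Pow {1..d}. \<Sum>k<n. \<gamma> u * P u i k)"
    by (intro sum.cong refl sum.swap)
  also have "\<dots> = (\<Sum>u\<in>Pow {1..d}. \<Sum>i<n. \<Sum>k<n. \<gamma> u * P u i k)" by (rule sum.swap)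
  finally have swap: "(\<Sum>i<n. \<Sum>k<n. \<Sum>u\<in>Pow {1..d}. \<gamma> u * P u i k) = (\<Sum>u\<in>Pow {1..d}. \<Sum>i<n. \<Sum>k<n. \<gamma> u * P u i k)" .
  have "1 / (real n)\<^sup>2 * (\<Sum>i<n. \<Sum>k<n. \<Sum>u\<in>Pow {1..d}. \<gamma> u * P u i k)
     = (\<Sum>u\<in>Pow {1..d}. \<gamma> u * (1 / (real n)\<^sup>2 * (\<Sum>i<n. \<Sum>k<n. P u i k)))"
    unfolding swap sum_distrib_left by (simp only: mult_ac)
  also have "\<dots> = \<gamma> {} * (1 / (real n)\<^sup>2 * (\<Sum>i<n. \<Sum>k<n. P {} i k)) + lattice_error d \<gamma> n z"
    unfolding lattice_error_def P_def by (rule sum.remove) auto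
  also have "(\<Sum>i<n. \<Sum>k<n. P {} i k) = (real n)\<^sup>2" by (simp add: P_def power2_eq_square)
  finally show ?thesis using n unfolding K by simp
qed

lemma worst_case_error_le:
  assumes r: "rkhs (unit_cube d) (sobolev_kernel d \<gamma>) H ip" and n: "n > 0"
  shows "worst_case_error d H ip n z \<le> ereal (sqrt (lattice_error d \<gamma> n z))"
  unfolding worst_case_error_def
proof (rule SUP_least)
  fix f assume "f \<in> {f \<in> H. sqrt (ip f f) \<le> 1}"
  then have f: "f \<in> H" and f1: "ip f f \<le> 1" by auto
  interpret rkhs "unit_cube d" "sobolev_kernel d \<gamma>" H ip by fact
  let ?M = "cube_measure d"
  have cdiag: "continuous_on (unit_cube d) (\<lambda>x. sobolev_kernel d \<gamma> x x)"
    unfolding sobolev_kernel_def by (intro continuous_intros continuous_on_coordinate)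
  have csec: "continuous_on (unit_cube d) (\<lambda>x. sobolev_kernel d \<gamma> x y)" for y
    unfolding sobolev_kernel_def by (intro continuous_intros continuous_on_coordinate)
  have diag: "sobolev_kernel d \<gamma> y y \<le> (\<Sum>u\<in>Pow {1..d}. \<bar>\<gamma> u\<bar>)" if y: "y \<in> unit_cube d" for y
    unfolding sobolev_kernel_def
  proof (rule sum_mono)
    fix u assume "u \<in> Pow {1..d}"
    then have "\<bar>\<gamma> u\<bar> * \<bar>\<Prod>j\<in>u. eta (y j) (y j)\<bar> \<le> \<bar>\<gamma> u\<bar> * 1"
      using abs_prod_eta_le_1[OF y y] by (intro mult_left_mono) auto
    then show "\<gamma> u * (\<Prod>j\<in>u. eta (y j) (y j)) \<le> \<bar>\<gamma> u\<bar>"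
      unfolding abs_mult[symmetric] by linarith
  qed
  have bound: "(cube_integral d h - lattice_rule d n z h)\<^sup>2 \<le> ip h h * lattice_error d \<gamma> n z" if h: "h \<in> H" for h
    unfolding cube_integral_eq lattice_rule_def sum_kernel_lattice[OF n, symmetric]
  proof (rule quadrature_error_bound[OF finite_measure_cube_measure _ space_cube_measure _ _ diag
        sobolev_kernel_mean h lattice_point_in_cube n])
    show "measure ?M (space ?M) = 1" by (simp add: measure_def emeasure_cube_measure)
    show "(\<lambda>y. sobolev_kernel d \<gamma> y y) \<in> borel_measurable ?M"
      by (rule continuous_on_imp_measurable_cube[OF cdiag])
    show "h \<in> borel_measurable ?M" if "h \<in> H" for h
      by (intro continuous_on_imp_measurable_cube rkhs_continuous_on[OF r that cdiag csec])
  qed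
  \<comment> \<open>Follows from the error bound of any nonzero element; without one, the kernel vanishes identically.\<close>
  have nonneg: "0 \<le> lattice_error d \<gamma> n z"
  proof (cases "\<exists>h\<in>H. ip h h \<noteq> 0")
    case True
    then obtain h where h: "h \<in> H" "ip h h > 0" using ip_nonneg by (metis less_eq_real_def)
    have "0 \<le> ip h h * lattice_error d \<gamma> n z" using bound[OF h(1)] by (rule order.trans[rotated]) simp
    then show ?thesis using h(2) by (simp add: zero_le_mult_iff)
  next
    case False
    have K0: "sobolev_kernel d \<gamma> x y = 0" if "x \<in> unit_cube d" "y \<in> unit_cube d" for x y
    proof -
      have "kernel_section (unit_cube d) (sobolev_kernel d \<gamma>) y = (\<lambda>_. 0)"
        using False kernel_mem[OF that(2)] ip_definite by blast
      from fun_cong[OF this, of x] show ?thesis using that by (simp add: kernel_section_def)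
    qed
    let ?y = "lattice_point d n z 0"
    have "\<gamma> {} = (\<integral>x. sobolev_kernel d \<gamma> x ?y \<partial>?M)"
      by (rule sobolev_kernel_mean[symmetric, OF lattice_point_in_cube])
    also have "\<dots> = (\<integral>x. 0 \<partial>?M)"
      by (rule Bochner_Integration.integral_cong)
         (auto simp: space_cube_measure intro!: K0 lattice_point_in_cube)
    finally show ?thesis
      unfolding sum_kernel_lattice[OF n, symmetric] by (simp add: K0 lattice_point_in_cube)
  qed
  have "(cube_integral d f - lattice_rule d n z f)\<^sup>2 \<le> 1 * lattice_error d \<gamma> n z"
    using bound[OF f] mult_right_mono[OF f1 nonneg] by linarith
  then show "ereal \<bar>cube_integral d f - lattice_rule d n z f\<bar> \<le> ereal (sqrt (lattice_error d \<gamma> n z))"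
    using real_le_rsqrt[of "\<bar>cube_integral d f - lattice_rule d n z f\<bar>"] by simp
qed

section \<open>Product weights\<close>

lemma C_const_pos: "0 < C_const u"
  unfolding C_const_def by (intro add_pos_pos zero_less_power divide_pos_pos mult_pos_pos) auto

lemma C_const_le: "C_const u \<le> 8 * 2 ^ card u"
proof -
  have "3 / pi\<^sup>2 \<le> 3 / 2\<^sup>2"
    using pi_ge_two by (intro divide_left_mono power_mono mult_pos_pos) auto
  then have "3 / pi\<^sup>2 + 5/6 \<le> 2" by simp
  then have "(3 / pi\<^sup>2 + 5/6) ^ card u \<le> 2 ^ card u" by (intro power_mono) auto
  moreover have "(2::real) / 3 ^ card u \<le> 2 * 2 ^ card u" "(1::real) / 4 ^ card u \<le> 1 * 2 ^ card u"
  proof -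
    have "(1 / 3 :: real) ^ card u \<le> 2 ^ card u" "(1 / 4 :: real) ^ card u \<le> 2 ^ card u"
      by (intro power_mono; simp)+
    then have "1 / 3 ^ card u \<le> (2::real) ^ card u" "1 / 4 ^ card u \<le> (2::real) ^ card u"
      by (simp_all add: power_one_over)
    then show "(2::real) / 3 ^ card u \<le> 2 * 2 ^ card u" "(1::real) / 4 ^ card u \<le> 1 * 2 ^ card u" by auto
  qed
  moreover have "(23/24 :: real) ^ card u \<le> 2 ^ card u" by (intro power_mono) auto
  ultimately show ?thesis unfolding C_const_def by linarith
qed

text \<open>
  Every summand of \<open>C_const\<close> is at most geometric in the cardinality, so the sum over all subsets of
  \<open>{1..N}\<close> is at most \<open>8\<close> times the product of the \<open>1 + 2 g j\<close>, hence bounded by an exponential of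
  the sum of the \<open>g j\<close>. Conversely, the singletons alone force summability.
\<close>

lemma product_weights_summable_iff:
  fixes \<gamma> :: "nat set \<Rightarrow> real" and g :: "nat \<Rightarrow> real"
  assumes g: "\<And>j. j \<ge> 1 \<Longrightarrow> 0 \<le> g j" and prod: "\<And>u. u \<in> finite_index_sets \<Longrightarrow> \<gamma> u = (\<Prod>j\<in>u. g j)"
  shows "(\<lambda>u. \<gamma> u * C_const u) summable_on finite_index_sets \<longleftrightarrow> summable (\<lambda>j. g (Suc j))"
proof
  assume "(\<lambda>u. \<gamma> u * C_const u) summable_on finite_index_sets"
  then have "(\<lambda>u. \<gamma> u * C_const u) summable_on range (\<lambda>j. {Suc j})"
    by (rule summable_on_subset_banach) (auto simp: finite_index_sets_def)
  then have "((\<lambda>u. \<gamma> u * C_const u) \<circ> (\<lambda>j. {Suc j})) summable_on UNIV"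
    by (subst (asm) summable_on_reindex) (auto simp: inj_on_def)
  moreover have "((\<lambda>u. \<gamma> u * C_const u) \<circ> (\<lambda>j. {Suc j})) = (\<lambda>j. C_const {1} * g (Suc j))"
    using prod by (auto simp: fun_eq_iff finite_index_sets_def C_const_def)
  ultimately have "summable (\<lambda>j. C_const {1} * g (Suc j))"
    using summable_on_imp_summable by metis
  then show "summable (\<lambda>j. g (Suc j))"
    using C_const_pos[of "{1}"] by (subst (asm) summable_cmult_iff) simp
next
  assume S: "summable (\<lambda>j. g (Suc j))"
  define T where "T = (\<Sum>j. g (Suc j))"
  show "(\<lambda>u. \<gamma> u * C_const u) summable_on finite_index_sets"
  proof (rule nonneg_bdd_above_summable_on)
    fix u assume u: "u \<in> finite_index_sets"
    then have "0 \<le> \<gamma> u" using prod[OF u] g by (auto simp: finite_index_sets_def intro!: prod_nonneg)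
    then show "0 \<le> \<gamma> u * C_const u" using C_const_pos[of u] by simp
  next
    show "bdd_above (sum (\<lambda>u. \<gamma> u * C_const u) ` {F. F \<subseteq> finite_index_sets \<and> finite F})"
    proof (rule bdd_aboveI2[where M = "8 * exp (2 * T)"])
      fix F assume "F \<in> {F. F \<subseteq> finite_index_sets \<and> finite F}"
      then have F: "F \<subseteq> finite_index_sets" "finite F" by auto
      have "finite (\<Union>F)" using F by (auto simp: finite_index_sets_def)
      then obtain N where N: "\<Union>F \<subseteq> {..N}" by (meson finite_nat_iff_bounded_le)
      have FP: "F \<subseteq> Pow {1..N}" using F N by (fastforce simp: finite_index_sets_def)
      have P: "u \<in> finite_index_sets" if "u \<in> Pow {1..N}" for u
        using that finite_subset[of u "{1..N}"] by (auto simp: finite_index_sets_def)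
      have nn: "0 \<le> (\<Prod>j\<in>u. 2 * g j)" if "u \<in> Pow {1..N}" for u
        using that g by (intro prod_nonneg) auto
      have "(\<Sum>u\<in>F. \<gamma> u * C_const u) \<le> (\<Sum>u\<in>F. 8 * (\<Prod>j\<in>u. 2 * g j))"
      proof (rule sum_mono)
        fix u assume u: "u \<in> F"
        then have uP: "u \<in> Pow {1..N}" using FP by blast
        have "0 \<le> \<gamma> u" unfolding prod[OF P[OF uP]] using uP g by (intro prod_nonneg) auto
        then have "\<gamma> u * C_const u \<le> \<gamma> u * (8 * 2 ^ card u)" by (intro mult_left_mono C_const_le)
        also have "\<dots> = 8 * (\<Prod>j\<in>u. 2 * g j)"
          unfolding prod[OF P[OF uP]] by (simp add: prod.distrib)
        finally show "\<gamma> u * C_const u \<le> 8 * (\<Prod>j\<in>u. 2 * g j)" .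
      qed
      also have "\<dots> \<le> (\<Sum>u\<in>Pow {1..N}. 8 * (\<Prod>j\<in>u. 2 * g j))"
        using FP nn by (intro sum_mono2) auto
      also have "\<dots> = 8 * (\<Prod>j\<in>{1..N}. 2 * g j + 1)"
        by (simp add: prod_add sum_distrib_left del: prod.distrib)
      also have "\<dots> = 8 * (\<Prod>j\<in>{1..N}. 1 + 2 * g j)" by (simp add: add.commute)
      also have "\<dots> \<le> 8 * exp (\<Sum>j\<in>{1..N}. 2 * g j)"
        using g by (intro mult_left_mono prod_le_exp_sum) auto
      also have "(\<Sum>j\<in>{1..N}. 2 * g j) = 2 * (\<Sum>j<N. g (Suc j))"
        unfolding One_nat_def sum.atLeast1_atMost_eq sum_distrib_left ..
      also have "8 * exp (2 * (\<Sum>j<N. g (Suc j))) \<le> 8 * exp (2 * T)"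
      proof -
        have "(\<Sum>j<N. g (Suc j)) \<le> T" unfolding T_def using g by (intro sum_le_suminf S) auto
        then show ?thesis by simp
      qed
      finally show "(\<Sum>u\<in>F. \<gamma> u * C_const u) \<le> 8 * exp (2 * T)" .
    qed
  qed
qed

section \<open>Averaging over all generating vectors\<close>

text \<open>
  The components of a generating vector vary independently, so the average of the product factorizes.
\<close>

lemma sum_generating_vectors_prod_eta:
  assumes u: "u \<subseteq> {1..d}" and n: "n > 1"
  shows "(\<Sum>z\<in>generating_vectors d n. \<Prod>j\<in>u. eta (frac (real i * real (z j) / real n)) (frac (real k * real (z j) / real n)))
    = real (n - 1) ^ d * mean_eta n i k ^ card u"
proof -
  define h where "h = (\<lambda>t::nat. eta (frac (real i * real t / real n)) (frac (real k * real t / real n)))"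
  have n1: "{1..n - 1} = {1..<n}" using n by auto
  have sub: "(\<Prod>j\<in>{1..d}. if j \<in> u then a j else 1) = (\<Prod>j\<in>u. a j)" for a :: "nat \<Rightarrow> real"
    using u by (simp add: prod.If_cases Int_absorb1)
  have "(\<Sum>z\<in>generating_vectors d n. \<Prod>j\<in>u. h (z j))
      = (\<Sum>z\<in>PiE {1..d} (\<lambda>_. {1..n - 1}). \<Prod>j\<in>{1..d}. if j \<in> u then h (z j) else 1)"
    unfolding generating_vectors_def sub ..
  also have "\<dots> = (\<Prod>j\<in>{1..d}. \<Sum>t\<in>{1..n - 1}. if j \<in> u then h t else 1)"
    by (rule prod_sum_PiE[symmetric]) auto
  also have "\<dots> = (\<Prod>j\<in>{1..d}. real (n - 1) * (if j \<in> u then mean_eta n i k else 1))"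
    unfolding n1 using n by (intro prod.cong refl) (simp add: h_def mean_eta_def)
  also have "\<dots> = real (n - 1) ^ d * mean_eta n i k ^ card u"
    unfolding prod.distrib sub by simp
  finally show ?thesis by (simp add: h_def)
qed

lemma exists_good_generating_vector:
  assumes nonneg: "\<And>u. u \<subseteq> {1..d} \<Longrightarrow> 0 \<le> \<gamma> u" and p: "prime n" and odd: "odd n"
  shows "\<exists>z\<in>generating_vectors d n. lattice_error d \<gamma> n z
    \<le> ln (real n) / sqrt (real n) * (\<Sum>u\<in>Pow {1..d} - {{}}. \<gamma> u * C_const u)"
proof (rule ccontr)
  define b where "b = ln (real n) / sqrt (real n) * (\<Sum>u\<in>Pow {1..d} - {{}}. \<gamma> u * C_const u)"
  define V where "V = real (n - 1) ^ d"
  let ?G = "generating_vectors d n"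
  let ?h = "\<lambda>i k t. eta (frac (real i * real (t::nat) / real n)) (frac (real k * real t / real n))"
  assume "\<not> ?thesis"
  then have less: "b < lattice_error d \<gamma> n z" if "z \<in> ?G" for z
    using that by (auto simp: b_def not_le)
  have n: "n > 1" using p by (rule prime_gt_1_nat)
  have finG: "finite ?G" and cardG: "real (card ?G) = V" and neG: "?G \<noteq> {}"
    using n by (auto simp: generating_vectors_def V_def card_PiE PiE_eq_empty_iff intro!: finite_PiE)
  have "V * b = (\<Sum>z\<in>?G. b)" using cardG by simp
  also have "\<dots> < (\<Sum>z\<in>?G. lattice_error d \<gamma> n z)"
    using finG neG less by (rule sum_strict_mono)
  also have "\<dots> = (\<Sum>u\<in>Pow {1..d} - {{}}. \<Sum>z\<in>?G. \<gamma> u * (1 / (real n)\<^sup>2 * (\<Sum>i<n. \<Sum>k<n. \<Prod>j\<in>u. ?h i k (z j))))"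
    unfolding lattice_error_def by (rule sum.swap)
  also have "\<dots> \<le> (\<Sum>u\<in>Pow {1..d} - {{}}. V * (\<gamma> u * (ln (real n) / sqrt (real n) * C_const u)))"
  proof (rule sum_mono)
    fix u assume u: "u \<in> Pow {1..d} - {{}}"
    then have ud: "u \<subseteq> {1..d}" and cu: "card u \<ge> 1"
      using finite_subset[of u "{1..d}"] by (auto simp: Suc_le_eq card_gt_0_iff)
    have "(\<Sum>z\<in>?G. \<Sum>i<n. \<Sum>k<n. \<Prod>j\<in>u. ?h i k (z j)) = (\<Sum>i<n. \<Sum>z\<in>?G. \<Sum>k<n. \<Prod>j\<in>u. ?h i k (z j))"
      by (rule sum.swap)
    also have "\<dots> = (\<Sum>i<n. \<Sum>k<n. \<Sum>z\<in>?G. \<Prod>j\<in>u. ?h i k (z j))"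
      by (intro sum.cong refl sum.swap)
    also have "\<dots> = V * (\<Sum>i<n. \<Sum>k<n. mean_eta n i k ^ card u)"
      unfolding sum_generating_vectors_prod_eta[OF ud n] V_def sum_distrib_left ..
    finally have "(\<Sum>z\<in>?G. \<gamma> u * (1 / (real n)\<^sup>2 * (\<Sum>i<n. \<Sum>k<n. \<Prod>j\<in>u. ?h i k (z j))))
      = V * (\<gamma> u * (1 / (real n)\<^sup>2 * (\<Sum>i<n. \<Sum>k<n. mean_eta n i k ^ card u)))"
      unfolding sum_distrib_left[symmetric] by (simp only: mult_ac)
    also have "\<dots> \<le> V * (\<gamma> u * (ln (real n) / sqrt (real n) * C_const u))"
    proof (intro mult_left_mono nonneg ud)
      have "1 / (real n)\<^sup>2 * (\<Sum>i<n. \<Sum>k<n. mean_eta n i k ^ card u)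
          \<le> ln (real n) / sqrt (real n) * (2 / 3 ^ card u + 4 * (23/24) ^ card u)"
        by (rule sum_mean_eta_power_le[OF p odd cu])
      also have "\<dots> \<le> ln (real n) / sqrt (real n) * C_const u"
        using n by (intro mult_left_mono) (auto simp: C_const_def)
      finally show "1 / (real n)\<^sup>2 * (\<Sum>i<n. \<Sum>k<n. mean_eta n i k ^ card u) \<le> ln (real n) / sqrt (real n) * C_const u" .
    qed (simp add: V_def)
    finally show "(\<Sum>z\<in>?G. \<gamma> u * (1 / (real n)\<^sup>2 * (\<Sum>i<n. \<Sum>k<n. \<Prod>j\<in>u. ?h i k (z j))))
      \<le> V * (\<gamma> u * (ln (real n) / sqrt (real n) * C_const u))" .
  qed
  also have "\<dots> = V * b" unfolding b_def sum_distrib_left by (simp only: mult_ac)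
  finally show False by simp
qed

theorem mainTheorem3:
  fixes \<gamma> :: "nat set \<Rightarrow> real"
    and H :: "nat \<Rightarrow> ((nat \<Rightarrow> real) \<Rightarrow> real) set"
    and ip :: "nat \<Rightarrow> ((nat \<Rightarrow> real) \<Rightarrow> real) \<Rightarrow> ((nat \<Rightarrow> real) \<Rightarrow> real) \<Rightarrow> real"
  assumes nonneg: "\<And>u. u \<in> finite_index_sets \<Longrightarrow> 0 \<le> \<gamma> u"
    and rkhs: "\<And>d. d \<ge> 1 \<Longrightarrow> rkhs (unit_cube d) (sobolev_kernel d \<gamma>) (H d) (ip d)"
  shows "(\<forall>d n. d \<ge> 1 \<longrightarrow> prime n \<longrightarrow> odd n \<longrightarrow>
           (\<exists>z\<in>generating_vectors d n.
             worst_case_error d (H d) (ip d) n z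
               \<le> ereal (sqrt (ln (real n) / sqrt (real n)
                          * (\<Sum>u\<in>Pow {1..d} - {{}}. \<gamma> u * C_const u)))))
       \<and> ((\<lambda>u. \<gamma> u * C_const u) summable_on finite_index_sets \<longrightarrow>
           (\<forall>d n. d \<ge> 1 \<longrightarrow> prime n \<longrightarrow> odd n \<longrightarrow>
             (\<exists>z\<in>generating_vectors d n.
               worst_case_error d (H d) (ip d) n z
                 \<le> ereal (sqrt (\<Sum>\<^sub>\<infinity>u\<in>finite_index_sets. \<gamma> u * C_const u)
                            * real n powr (- 1/4) * sqrt (ln (real n))))))
       \<and> (\<forall>g :: nat \<Rightarrow> real. (\<forall>j\<ge>1. 0 \<le> g j) \<longrightarrow>
           (\<forall>u\<in>finite_index_sets. \<gamma> u = (\<Prod>j\<in>u. g j)) \<longrightarrow>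
           ((\<lambda>u. \<gamma> u * C_const u) summable_on finite_index_sets
             \<longleftrightarrow> summable (\<lambda>j. g (Suc j))))"
proof (intro conjI allI impI)
  have fis: "u \<in> finite_index_sets" if "u \<subseteq> {1..d}" for u d
    using finite_subset[OF that] that by (simp add: finite_index_sets_def subset_iff)
  have main: "\<exists>z\<in>generating_vectors d n. worst_case_error d (H d) (ip d) n z
      \<le> ereal (sqrt (ln (real n) / sqrt (real n) * (\<Sum>u\<in>Pow {1..d} - {{}}. \<gamma> u * C_const u)))"
    if d: "d \<ge> 1" and p: "prime n" and o: "odd n" for d n
  proof -
    have nn: "0 \<le> \<gamma> u" if "u \<subseteq> {1..d}" for u using nonneg[OF fis[OF that]] .
    obtain z where z: "z \<in> generating_vectors d n" and le: "lattice_error d \<gamma> n z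
        \<le> ln (real n) / sqrt (real n) * (\<Sum>u\<in>Pow {1..d} - {{}}. \<gamma> u * C_const u)"
      using exists_good_generating_vector[of d \<gamma>, OF nn p o] by blast
    have "worst_case_error d (H d) (ip d) n z \<le> ereal (sqrt (lattice_error d \<gamma> n z))"
      using worst_case_error_le[OF rkhs[OF d] prime_gt_0_nat[OF p]] .
    also have "\<dots> \<le> ereal (sqrt (ln (real n) / sqrt (real n) * (\<Sum>u\<in>Pow {1..d} - {{}}. \<gamma> u * C_const u)))"
      using le by simp
    finally show ?thesis using z by blast
  qed
  show "\<exists>z\<in>generating_vectors d n. worst_case_error d (H d) (ip d) n z
      \<le> ereal (sqrt (ln (real n) / sqrt (real n) * (\<Sum>u\<in>Pow {1..d} - {{}}. \<gamma> u * C_const u)))"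
    if "d \<ge> 1" "prime n" "odd n" for d n using main[OF that] .
  show "\<exists>z\<in>generating_vectors d n. worst_case_error d (H d) (ip d) n z
      \<le> ereal (sqrt (\<Sum>\<^sub>\<infinity>u\<in>finite_index_sets. \<gamma> u * C_const u) * real n powr (- 1/4) * sqrt (ln (real n)))"
    if S: "(\<lambda>u. \<gamma> u * C_const u) summable_on finite_index_sets" and d: "d \<ge> 1" and p: "prime n" and o: "odd n" for d n
  proof -
    define c where "c = (\<Sum>\<^sub>\<infinity>u\<in>finite_index_sets. \<gamma> u * C_const u)"
    have n: "n > 1" using p by (rule prime_gt_1_nat)
    have "(\<Sum>u\<in>Pow {1..d} - {{}}. \<gamma> u * C_const u) \<le> c"
      unfolding c_def
    proof (rule finite_sum_le_infsum[OF S])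
      show "Pow {1..d} - {{}} \<subseteq> finite_index_sets" using fis by blast
      show "0 \<le> \<gamma> u * C_const u" if "u \<in> finite_index_sets - (Pow {1..d} - {{}})" for u
        using that nonneg[of u] C_const_pos[of u] by simp
    qed simp
    then have "ln (real n) / sqrt (real n) * (\<Sum>u\<in>Pow {1..d} - {{}}. \<gamma> u * C_const u) \<le> ln (real n) / sqrt (real n) * c"
      using n by (intro mult_left_mono) auto
    then have "sqrt (ln (real n) / sqrt (real n) * (\<Sum>u\<in>Pow {1..d} - {{}}. \<gamma> u * C_const u)) \<le> sqrt (ln (real n) / sqrt (real n) * c)"
      by simp
    also have "\<dots> = sqrt c * real n powr (- 1/4) * sqrt (ln (real n))"
    proof -
      have "sqrt (1 / sqrt (real n)) = real n powr (- 1/4)"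
        using n by (simp add: powr_half_sqrt[symmetric] powr_powr powr_minus_divide[symmetric])
      moreover have "ln (real n) / sqrt (real n) * c = c * (1 / sqrt (real n)) * ln (real n)" by simp
      ultimately show ?thesis by (simp only: real_sqrt_mult)
    qed
    finally show ?thesis
      using main[OF d p o] unfolding c_def by (meson ereal_less_eq(3) order.trans)
  qed
  show "(\<lambda>u. \<gamma> u * C_const u) summable_on finite_index_sets \<longleftrightarrow> summable (\<lambda>j. g (Suc j))"
    if "\<forall>j\<ge>1. 0 \<le> g j" "\<forall>u\<in>finite_index_sets. \<gamma> u = (\<Prod>j\<in>u. g j)" for g :: "nat \<Rightarrow> real"
    using that by (intro product_weights_summable_iff) auto
qed

end
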